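(* Let $\tau>0$. The intensity measure $A\mapsto\mathbb E\,\mathrm{Sch}_\tau(A)$ (on Borel sets $A\subset\mathbb R$) has density $$\sum_{k\in\mathbb Z}p(2\pi k+x),\qquad p(y)=\frac1{\sqrt{3\pi\tau}}\,e^{-\frac{1}{3\tau}y^2},$$ at $x\in\mathbb R$. (This is the density of a centered normal random variable with variance $\frac32\tau$ mod $2\pi$.)
   Context: Let $\mathcal B,\mathcal B_2,\mathcal B_3$ be independent standard real Brownian motions, $\mathcal W=\frac1{\sqrt2}(\mathcal B_2+i\mathcal B_3)$, and let $\varphi^\lambda(t)$, $\lambda\in\mathbb R$, be the solutions, all driven by the same $\mathcal B,\mathcal W$, of $d\varphi^\lambda=\lambda\,dt+d\mathcal B+\mathrm{Re}[e^{-i\varphi^\lambda}d\mathcal W]$, $\varphi^\lambda(0)=0$ (in the version for which $\lambda\mapsto\varphi^\lambda(t)$ is strictly increasing and real-analytic for $t>0$). $\mathrm{Sch}_\tau=\{\lambda\in\mathbb R:\varphi^{\lambda/\tau}(\tau)\in2\pi\mathbb Z\}$, and $\mathrm{Sch}_\tau(A)$ denotes the number of points of $\mathrm{Sch}_\tau$ in $A$. *)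

theory Defs
  imports "HOL-Probability.Probability" "HOL-Library.Real_Mod"
begin

text \<open>
  Processes are indexed by \<open>real\<close>, but only times \<open>t \<ge> 0\<close> are ever constrained.
\<close>

definition standard_brownian_motion :: "'a measure \<Rightarrow> (real \<Rightarrow> 'a \<Rightarrow> real) \<Rightarrow> bool" where
  "standard_brownian_motion M B \<longleftrightarrow>
     prob_space M \<and>
     (\<forall>t\<ge>0. B t \<in> borel_measurable M) \<and>
     (AE \<omega> in M. B 0 \<omega> = 0) \<and>
     (\<forall>\<omega>\<in>space M. continuous_on {0..} (\<lambda>t. B t \<omega>)) \<and>
     (\<forall>s t. 0 \<le> s \<and> s < t \<longrightarrow>
        distributed M lborel (\<lambda>\<omega>. B t \<omega> - B s \<omega>) (normal_density 0 (sqrt (t - s)))) \<and>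
     (\<forall>n (t :: nat \<Rightarrow> real). 0 \<le> t 0 \<and> (\<forall>i<n. t i \<le> t (Suc i)) \<longrightarrow>
        prob_space.indep_vars M (\<lambda>_. borel) (\<lambda>i \<omega>. B (t (Suc i)) \<omega> - B (t i) \<omega>) {..<n})"

text \<open>Mutual independence of whole processes, viewed as random elements of \<open>\<real>\<^bsup>[0,\<infinity>)\<^esup>\<close>.\<close>

definition independent_processes :: "'a measure \<Rightarrow> (real \<Rightarrow> 'a \<Rightarrow> real) list \<Rightarrow> bool" where
  "independent_processes M Bs \<longleftrightarrow>
     prob_space.indep_vars M (\<lambda>_. PiM {0..} (\<lambda>_. borel))
       (\<lambda>i \<omega>. \<lambda>t\<in>{0..}. (Bs ! i) t \<omega>) {..<length Bs}"

definition adapted :: "(real \<Rightarrow> 'a measure) \<Rightarrow> (real \<Rightarrow> 'a \<Rightarrow> 'b::topological_space) \<Rightarrow> bool" where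
  "adapted F X \<longleftrightarrow> (\<forall>t\<ge>0. X t \<in> borel_measurable (F t))"

text \<open>
  \<open>F\<close> is a filtration for which \<open>(B, B2, B3)\<close> is an \<open>F\<close>-Brownian motion: the three processes
  are adapted and their joint increments after time \<open>s\<close> are independent of \<open>F s\<close>. The filtration generated by
  \<open>(B, B2, B3)\<close>, with or without its augmentation by null sets, is an example.
\<close>

definition brownian_filtration ::
  "'a measure \<Rightarrow> (real \<Rightarrow> 'a measure) \<Rightarrow>
   (real \<Rightarrow> 'a \<Rightarrow> real) \<Rightarrow> (real \<Rightarrow> 'a \<Rightarrow> real) \<Rightarrow> (real \<Rightarrow> 'a \<Rightarrow> real) \<Rightarrow> bool" where
  "brownian_filtration M F B B2 B3 \<longleftrightarrow>
     filtration (space M) F \<and> (\<forall>t. subalgebra M (F t)) \<and>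
     adapted F B \<and> adapted F B2 \<and> adapted F B3 \<and>
     (\<forall>s t. 0 \<le> s \<and> s \<le> t \<longrightarrow>
        prob_space.indep_set M (sets (F s))
          (sets (vimage_algebra (space M)
            (\<lambda>\<omega>. (B t \<omega> - B s \<omega>, B2 t \<omega> - B2 s \<omega>, B3 t \<omega> - B3 s \<omega>))
            (borel \<Otimes>\<^sub>M borel \<Otimes>\<^sub>M borel))))"

definition complex_noise ::
  "(real \<Rightarrow> 'a \<Rightarrow> real) \<Rightarrow> (real \<Rightarrow> 'a \<Rightarrow> real) \<Rightarrow> real \<Rightarrow> 'a \<Rightarrow> complex" where
  "complex_noise B2 B3 t \<omega> =
     complex_of_real (1 / sqrt 2) * (complex_of_real (B2 t \<omega>) + \<i> * complex_of_real (B3 t \<omega>))"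

subsection \<open>Ito integral over \<open>[0,T]\<close>\<close>

text \<open>
  A simple process \<open>\<Sum>i<n. \<xi> i * 1\<^bsub>(u i, u (i+1)]\<^esub>\<close> with bounded \<open>F (u i)\<close>-measurable
  coefficients, and its integral against \<open>W\<close>.
\<close>

definition simple_integrand ::
  "(real \<Rightarrow> 'a measure) \<Rightarrow> real \<Rightarrow> nat \<Rightarrow> (nat \<Rightarrow> real) \<Rightarrow> (nat \<Rightarrow> 'a \<Rightarrow> complex) \<Rightarrow> bool" where
  "simple_integrand F T n u \<xi> \<longleftrightarrow>
     0 \<le> u 0 \<and> (\<forall>i<n. u i \<le> u (Suc i)) \<and> u n \<le> T \<and>
     (\<forall>i<n. \<xi> i \<in> borel_measurable (F (u i))) \<and>
     (\<exists>C. \<forall>i<n. \<forall>\<omega>\<in>space (F (u i)). norm (\<xi> i \<omega>) \<le> C)"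

definition simple_process ::
  "nat \<Rightarrow> (nat \<Rightarrow> real) \<Rightarrow> (nat \<Rightarrow> 'a \<Rightarrow> complex) \<Rightarrow> real \<Rightarrow> 'a \<Rightarrow> complex" where
  "simple_process n u \<xi> s \<omega> = (\<Sum>i<n. \<xi> i \<omega> * indicator {u i<..u (Suc i)} s)"

definition simple_integral ::
  "(real \<Rightarrow> 'a \<Rightarrow> complex) \<Rightarrow> nat \<Rightarrow> (nat \<Rightarrow> real) \<Rightarrow> (nat \<Rightarrow> 'a \<Rightarrow> complex) \<Rightarrow> 'a \<Rightarrow> complex" where
  "simple_integral W n u \<xi> \<omega> = (\<Sum>i<n. \<xi> i \<omega> * (W (u (Suc i)) \<omega> - W (u i) \<omega>))"

text \<open>
  \<open>J\<close> is (a version of) the Ito integral \<open>\<integral>\<^sub>0\<^sup>T H dW\<close>: the mean-square limit of the integrals of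
  simple processes converging to \<open>H\<close> in \<open>L\<^sup>2(ds \<otimes> P)\<close> on \<open>[0,T]\<close>.
\<close>

definition has_ito_integral ::
  "'a measure \<Rightarrow> (real \<Rightarrow> 'a measure) \<Rightarrow> (real \<Rightarrow> 'a \<Rightarrow> complex) \<Rightarrow> (real \<Rightarrow> 'a \<Rightarrow> complex) \<Rightarrow>
   real \<Rightarrow> ('a \<Rightarrow> complex) \<Rightarrow> bool" where
  "has_ito_integral M F W H T J \<longleftrightarrow>
     adapted F H \<and>
     (\<lambda>(s, \<omega>). H s \<omega>) \<in> borel_measurable (restrict_space borel {0..T} \<Otimes>\<^sub>M M) \<and>
     J \<in> borel_measurable M \<and>
     (\<exists>n u \<xi>.
        (\<forall>m::nat. simple_integrand F T (n m) (u m) (\<xi> m)) \<and>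
        (\<lambda>m. \<integral>\<^sup>+\<omega>. (\<integral>\<^sup>+s\<in>{0..T}.
             ennreal ((norm (simple_process (n m) (u m) (\<xi> m) s \<omega> - H s \<omega>))\<^sup>2) \<partial>lborel) \<partial>M)
          \<longlonglongrightarrow> 0 \<and>
        (\<lambda>m. \<integral>\<^sup>+\<omega>. ennreal ((norm (simple_integral W (n m) (u m) (\<xi> m) \<omega> - J \<omega>))\<^sup>2) \<partial>M)
          \<longlonglongrightarrow> 0)"

subsection \<open>The phase equation and its level set\<close>

text \<open>\<open>\<phi>\<close> is an adapted continuous solution of
  \<open>d\<phi> = l dt + dB + Re [e\<^sup>-\<^sup>i\<^sup>\<phi> dW]\<close>, \<open>\<phi>(0) = 0\<close>.\<close>

definition solves_phase_sde ::
  "'a measure \<Rightarrow> (real \<Rightarrow> 'a measure) \<Rightarrow> (real \<Rightarrow> 'a \<Rightarrow> real) \<Rightarrow> (real \<Rightarrow> 'a \<Rightarrow> complex) \<Rightarrow>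
   real \<Rightarrow> (real \<Rightarrow> 'a \<Rightarrow> real) \<Rightarrow> bool" where
  "solves_phase_sde M F B W l \<phi> \<longleftrightarrow>
     adapted F \<phi> \<and>
     (\<forall>\<omega>\<in>space M. continuous_on {0..} (\<lambda>t. \<phi> t \<omega>)) \<and>
     (AE \<omega> in M. \<phi> 0 \<omega> = 0) \<and>
     (\<forall>t\<ge>0. \<exists>J.
        has_ito_integral M F W (\<lambda>s \<omega>. exp (- \<i> * complex_of_real (\<phi> s \<omega>))) t J \<and>
        (AE \<omega> in M. \<phi> t \<omega> = l * t + B t \<omega> + Re (J \<omega>)))"

definition real_analytic :: "(real \<Rightarrow> real) \<Rightarrow> bool" where
  "real_analytic f \<longleftrightarrow>
     (\<forall>x. \<exists>a. \<exists>r>0. \<forall>y. \<bar>y - x\<bar> < r \<longrightarrow> (\<lambda>n. a n * (y - x) ^ n) sums f y)"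

definition Sch :: "(real \<Rightarrow> real \<Rightarrow> 'a \<Rightarrow> real) \<Rightarrow> real \<Rightarrow> 'a \<Rightarrow> real set" where
  "Sch \<phi> \<tau> \<omega> = {x. \<exists>k::int. \<phi> (x / \<tau>) \<tau> \<omega> = 2 * pi * of_int k}"

text \<open>Number of points in a set, with value \<open>\<infinity>\<close> for infinite sets.\<close>

definition Sch_count ::
  "(real \<Rightarrow> real \<Rightarrow> 'a \<Rightarrow> real) \<Rightarrow> real \<Rightarrow> real set \<Rightarrow> 'a \<Rightarrow> ennreal" where
  "Sch_count \<phi> \<tau> A \<omega> = emeasure (count_space UNIV) (Sch \<phi> \<tau> \<omega> \<inter> A)"

definition p_dens :: "real \<Rightarrow> real \<Rightarrow> real" where
  "p_dens \<tau> y = 1 / sqrt (3 * pi * \<tau>) * exp (- (1 / (3 * \<tau>)) * y\<^sup>2)"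

definition intensity_dens :: "real \<Rightarrow> real \<Rightarrow> real" where
  "intensity_dens \<tau> x = (\<Sum>\<^sub>\<infinity>k\<in>(UNIV :: int set). p_dens \<tau> (2 * pi * of_int k + x))"

end

theory Submission
  imports Defs
begin

text \<open>
  Write \<open>f x = \<phi>\<^bsup>x/\<tau>\<^esup>(\<tau>)\<close>, so that the points of \<open>Sch\<close> are the solutions of \<open>f x \<in> 2\<pi>\<int>\<close>. Two facts
  give the intensity.

  First, \<open>f x\<close> is normal with mean \<open>x\<close> and variance \<open>3\<tau>/2\<close> for every fixed \<open>x\<close>. The integrand
  \<open>e\<^bsup>-i\<phi>\<^esup>\<close> has modulus one, and \<open>W\<close> is invariant in law under rotations, so \<open>Re \<integral> e\<^bsup>-i\<phi>\<^esup> dW\<close>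
  contributes the variance \<open>\<tau>/2\<close> on top of the variance \<open>\<tau>\<close> of \<open>B\<close>. The proof discretises: for a simple integrand
  all of whose coefficients have modulus one, the value of \<open>B + Re \<integral> \<eta> dW\<close> is exactly normal, because
  its characteristic function factors over the intervals by conditioning on the past
  (\<open>unit_sum_char\<close>). A simple approximation \<open>\<xi>\<close> of \<open>e\<^bsup>-i\<phi>\<^esup>\<close> can be replaced by its direction \<open>\<xi>/|\<xi>|\<close>,
  since the direction is the point of the circle nearest to \<open>\<xi>\<close>; the replacement therefore costs no more
  than the error of \<open>\<xi>\<close>, and the Ito isometry (\<open>ito_isometry\<close>) transfers this to the
  integrals (\<open>unit_approximation\<close>). The characteristic function then passes to the mean-square limit
  (\<open>unit_ito_integral_normal\<close>, \<open>phase_law\<close>).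

  Second, only these one-dimensional laws matter. Almost surely \<open>f\<close> is continuous, strictly
  increasing and unbounded in both directions, so it takes the value \<open>2\<pi>k\<close> at exactly one point \<open>N\<^sub>k\<close>,
  and \<open>N\<^sub>k \<le> a\<close> holds exactly when \<open>f a \<ge> 2\<pi>k\<close>. By the symmetry of the normal law, \<open>N\<^sub>k\<close> is normal with mean
  \<open>2\<pi>k\<close> and variance \<open>3\<tau>/2\<close> (\<open>normal_drift_crossing\<close>). The number of points in \<open>A\<close> is
  \<open>\<Sum>\<^sub>k 1(N\<^sub>k \<in> A)\<close>, and its expectation is the integral over \<open>A\<close> of the sum of the densities of the \<open>N\<^sub>k\<close>.

  The law modulo \<open>2\<pi>\<close> is computed by cutting the line into periods (\<open>nn_integral_period_decomposition\<close>).
\<close>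

section \<open>Averaging over independent noise\<close>

text \<open>
  Independence is expressed as a product law, so that \<open>X\<close> and \<open>G\<close> may take values in different types. The
  two integral formulas below play the part of conditioning on \<open>A\<close>: freeze \<open>X\<close>, then average over an
  independent copy of \<open>G\<close>.
\<close>

lemma (in prob_space) distr_Pair_indep_set:
  assumes A: "subalgebra M A" and ind: "indep_set (sets A) (sets (vimage_algebra (space M) G T))"
    and X: "X \<in> A \<rightarrow>\<^sub>M S" and G: "G \<in> M \<rightarrow>\<^sub>M T"
  shows "distr M (S \<Otimes>\<^sub>M T) (\<lambda>\<omega>. (X \<omega>, G \<omega>)) = distr M S X \<Otimes>\<^sub>M distr M T G"
proof -
  have XM[measurable]: "X \<in> M \<rightarrow>\<^sub>M S"
    by (rule measurable_from_subalg[OF A X])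
  note G[measurable]
  interpret X: prob_space "distr M S X" by (rule prob_space_distr) simp
  interpret G: prob_space "distr M T G" by (rule prob_space_distr) simp
  show ?thesis
  proof (rule pair_measure_eqI[symmetric])
    fix C D assume "C \<in> sets (distr M S X)" "D \<in> sets (distr M T G)"
    then have C: "C \<in> sets S" and D: "D \<in> sets T" by auto
    have "space A = space M"
      using A by (auto simp: subalgebra_def)
    then have 1: "X -` C \<inter> space M \<in> sets A"
      using measurable_sets[OF X C] by simp
    have 2: "G -` D \<inter> space M \<in> sets (vimage_algebra (space M) G T)"
      by (rule in_vimage_algebra[OF D])
    have "(\<lambda>\<omega>. (X \<omega>, G \<omega>)) -` (C \<times> D) \<inter> space M = (X -` C \<inter> space M) \<inter> (G -` D \<inter> space M)"
      by auto
    moreover have "prob ((X -` C \<inter> space M) \<inter> (G -` D \<inter> space M))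
        = prob (X -` C \<inter> space M) * prob (G -` D \<inter> space M)"
      by (rule indep_setD[OF ind 1 2])
    ultimately show "emeasure (distr M S X) C * emeasure (distr M T G) D
        = emeasure (distr M (S \<Otimes>\<^sub>M T) (\<lambda>\<omega>. (X \<omega>, G \<omega>))) (C \<times> D)"
      using C D by (simp add: emeasure_distr emeasure_eq_measure ennreal_mult)
  qed (auto intro: X.sigma_finite_measure_axioms G.sigma_finite_measure_axioms cong: sets_pair_measure_cong)
qed

lemma (in prob_space) nn_integral_indep_set:
  assumes A: "subalgebra M A" and ind: "indep_set (sets A) (sets (vimage_algebra (space M) G T))"
    and X: "X \<in> A \<rightarrow>\<^sub>M S" and G[measurable]: "G \<in> M \<rightarrow>\<^sub>M T"
    and f[measurable]: "f \<in> borel_measurable (S \<Otimes>\<^sub>M T)"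
  shows "(\<integral>\<^sup>+\<omega>. f (X \<omega>, G \<omega>) \<partial>M) = (\<integral>\<^sup>+\<omega>. (\<integral>\<^sup>+\<omega>'. f (X \<omega>, G \<omega>') \<partial>M) \<partial>M)"
proof -
  have [measurable]: "X \<in> M \<rightarrow>\<^sub>M S"
    by (rule measurable_from_subalg[OF A X])
  interpret G: prob_space "distr M T G" by (rule prob_space_distr) simp
  have "(\<integral>\<^sup>+\<omega>. f (X \<omega>, G \<omega>) \<partial>M) = (\<integral>\<^sup>+p. f p \<partial>distr M (S \<Otimes>\<^sub>M T) (\<lambda>\<omega>. (X \<omega>, G \<omega>)))"
    by (simp add: nn_integral_distr)
  also have "\<dots> = (\<integral>\<^sup>+p. f p \<partial>(distr M S X \<Otimes>\<^sub>M distr M T G))"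
    by (simp add: distr_Pair_indep_set[OF A ind X G])
  also have "\<dots> = (\<integral>\<^sup>+x. \<integral>\<^sup>+g. f (x, g) \<partial>distr M T G \<partial>distr M S X)"
    by (rule G.nn_integral_fst[symmetric]) simp
  also have "\<dots> = (\<integral>\<^sup>+\<omega>. (\<integral>\<^sup>+g. f (X \<omega>, g) \<partial>distr M T G) \<partial>M)"
    by (subst nn_integral_distr) auto
  also have "\<dots> = (\<integral>\<^sup>+\<omega>. (\<integral>\<^sup>+\<omega>'. f (X \<omega>, G \<omega>') \<partial>M) \<partial>M)"
    by (intro nn_integral_cong nn_integral_distr) (auto dest: measurable_space)
  finally show ?thesis .
qed

lemma (in prob_space) integral_indep_set:
  fixes f :: "'b \<times> 'c \<Rightarrow> complex"
  assumes A: "subalgebra M A" and ind: "indep_set (sets A) (sets (vimage_algebra (space M) G T))"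
    and X: "X \<in> A \<rightarrow>\<^sub>M S" and G[measurable]: "G \<in> M \<rightarrow>\<^sub>M T"
    and f[measurable]: "f \<in> borel_measurable (S \<Otimes>\<^sub>M T)" and bnd: "\<And>x. norm (f x) \<le> C"
  shows "(\<integral>\<omega>. f (X \<omega>, G \<omega>) \<partial>M) = (\<integral>\<omega>. (\<integral>\<omega>'. f (X \<omega>, G \<omega>') \<partial>M) \<partial>M)"
proof -
  have [measurable]: "X \<in> M \<rightarrow>\<^sub>M S"
    by (rule measurable_from_subalg[OF A X])
  interpret G: prob_space "distr M T G" by (rule prob_space_distr) simp
  interpret X: prob_space "distr M S X" by (rule prob_space_distr) simp
  interpret P: pair_prob_space "distr M S X" "distr M T G" ..
  have "(\<integral>\<omega>. f (X \<omega>, G \<omega>) \<partial>M) = (\<integral>p. f p \<partial>distr M (S \<Otimes>\<^sub>M T) (\<lambda>\<omega>. (X \<omega>, G \<omega>)))"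
    by (simp add: integral_distr)
  also have "\<dots> = (\<integral>p. f p \<partial>(distr M S X \<Otimes>\<^sub>M distr M T G))"
    by (simp add: distr_Pair_indep_set[OF A ind X G])
  also have "\<dots> = (\<integral>x. \<integral>g. f (x, g) \<partial>distr M T G \<partial>distr M S X)"
    by (rule P.integral_fst'[symmetric], rule P.integrable_const_bound[of _ C]) (use bnd in auto)
  also have "\<dots> = (\<integral>\<omega>. (\<integral>g. f (X \<omega>, g) \<partial>distr M T G) \<partial>M)"
    by (subst integral_distr) auto
  also have "\<dots> = (\<integral>\<omega>. (\<integral>\<omega>'. f (X \<omega>, G \<omega>') \<partial>M) \<partial>M)"
    by (intro Bochner_Integration.integral_cong refl integral_distr) (auto dest: measurable_space)
  finally show ?thesis .
qed

section \<open>Normal random variables\<close>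

lemma (in prob_space) char_normal:
  assumes X: "distributed M lborel X (normal_density 0 \<sigma>)" and \<sigma>: "\<sigma> > 0"
  shows "(\<integral>\<omega>. iexp (r * X \<omega>) \<partial>M) = exp (- (\<sigma>\<^sup>2 * r\<^sup>2 / 2))"
proof -
  have [measurable]: "X \<in> borel_measurable M"
    using distributed_measurable[OF X] by simp
  have Y: "distributed M lborel (\<lambda>\<omega>. (X \<omega> - 0) / \<sigma>) std_normal_density"
    using X normal_standard_normal_convert[OF \<sigma>, of X 0] by simp
  have "(\<integral>\<omega>. iexp (r * X \<omega>) \<partial>M) = (\<integral>\<omega>. iexp ((r * \<sigma>) * ((X \<omega> - 0) / \<sigma>)) \<partial>M)"
    using \<sigma> by (intro Bochner_Integration.integral_cong) auto
  also have "\<dots> = char (distr M lborel (\<lambda>\<omega>. (X \<omega> - 0) / \<sigma>)) (r * \<sigma>)"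
    unfolding char_def by (subst integral_distr) auto
  also have "\<dots> = char std_normal_distribution (r * \<sigma>)"
    using distributed_distr_eq_density[OF Y] by simp
  also have "\<dots> = exp (- (\<sigma>\<^sup>2 * r\<^sup>2 / 2))"
    by (simp add: char_std_normal_distribution power_mult_distrib mult.commute exp_of_real)
  finally show ?thesis .
qed

lemma (in prob_space) normal_moments:
  assumes X: "distributed M lborel X (normal_density 0 \<sigma>)" and \<sigma>: "\<sigma> > 0"
  shows "integrable M X" "(\<integral>\<omega>. X \<omega> \<partial>M) = 0" "integrable M (\<lambda>\<omega>. (X \<omega>)\<^sup>2)" "(\<integral>\<omega>. (X \<omega>)\<^sup>2 \<partial>M) = \<sigma>\<^sup>2"
proof -
  show "integrable M X"
    using distributed_integrable_var[OF X] integrable_normal_moment_nz_1[OF \<sigma>, of 0]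
    by (simp add: normal_density_nonneg)
  show "(\<integral>\<omega>. X \<omega> \<partial>M) = 0"
    using distributed_integral[OF X, of "\<lambda>x. x"] integral_normal_moment_nz_1[OF \<sigma>, of 0]
    by (simp add: normal_density_nonneg)
  have "integrable lborel (\<lambda>x. normal_density 0 \<sigma> x * x\<^sup>2)"
    using integrable_normal_moment[OF \<sigma>, of 0 2] by simp
  then show "integrable M (\<lambda>\<omega>. (X \<omega>)\<^sup>2)"
    using distributed_integrable[OF X, of "\<lambda>x. x\<^sup>2"] by (simp add: normal_density_nonneg)
  show "(\<integral>\<omega>. (X \<omega>)\<^sup>2 \<partial>M) = \<sigma>\<^sup>2"
    using distributed_integral[OF X, of "\<lambda>x. x\<^sup>2"] integral_normal_moment_even[OF \<sigma>, of 0 1]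
    by (simp add: normal_density_nonneg)
qed

section \<open>Increments of the driving Brownian motions\<close>

locale brownian_triple = prob_space M for M :: "'a measure" +
  fixes F :: "real \<Rightarrow> 'a measure" and B B2 B3 :: "real \<Rightarrow> 'a \<Rightarrow> real"
  assumes bm: "standard_brownian_motion M B" "standard_brownian_motion M B2" "standard_brownian_motion M B3"
    and indep: "independent_processes M [B, B2, B3]"
    and filt: "brownian_filtration M F B B2 B3"
begin

abbreviation W :: "real \<Rightarrow> 'a \<Rightarrow> complex" where "W \<equiv> complex_noise B2 B3"

lemma subalg: "subalgebra M (F t)"
  using filt by (simp add: brownian_filtration_def)

lemma measurable_M: "X \<in> F t \<rightarrow>\<^sub>M N \<Longrightarrow> X \<in> M \<rightarrow>\<^sub>M N"
  by (rule measurable_from_subalg[OF subalg])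

lemma measurable_F_mono: "s \<le> t \<Longrightarrow> X \<in> F s \<rightarrow>\<^sub>M N \<Longrightarrow> X \<in> F t \<rightarrow>\<^sub>M N"
proof (rule measurable_from_subalg)
  assume "s \<le> t"
  moreover have "filtration (space M) F"
    using filt by (simp add: brownian_filtration_def)
  ultimately show "subalgebra (F t) (F s)"
    by (auto simp: subalgebra_def filtration.space_F dest: filtration.sets_F_mono)
qed

lemma B_measurable_F:
  assumes "0 \<le> s" "s \<le> t"
  shows "B s \<in> borel_measurable (F t)" "W s \<in> borel_measurable (F t)"
proof -
  have "B s \<in> borel_measurable (F s)" "B2 s \<in> borel_measurable (F s)" "B3 s \<in> borel_measurable (F s)"
    using filt assms by (auto simp: brownian_filtration_def adapted_def)
  note [measurable] = measurable_F_mono[OF \<open>s \<le> t\<close> this(1)] measurable_F_mono[OF \<open>s \<le> t\<close> this(2)]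
    measurable_F_mono[OF \<open>s \<le> t\<close> this(3)]
  show "B s \<in> borel_measurable (F t)"
    by measurable
  show "W s \<in> borel_measurable (F t)"
    unfolding complex_noise_def[abs_def] by measurable
qed

lemma B_measurable [measurable]:
  assumes "0 \<le> s"
  shows "B s \<in> borel_measurable M" "B2 s \<in> borel_measurable M" "B3 s \<in> borel_measurable M" "W s \<in> borel_measurable M"
proof -
  show 1[measurable]: "B s \<in> borel_measurable M" "B2 s \<in> borel_measurable M" "B3 s \<in> borel_measurable M"
    using bm assms by (auto simp: standard_brownian_motion_def)
  show "W s \<in> borel_measurable M"
    using B_measurable_F(2)[OF assms order_refl] by (rule measurable_M)
qed

definition increment :: "real \<Rightarrow> real \<Rightarrow> 'a \<Rightarrow> real \<times> real \<times> real" where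
  "increment s t \<omega> = (B t \<omega> - B s \<omega>, B2 t \<omega> - B2 s \<omega>, B3 t \<omega> - B3 s \<omega>)"

lemma increment_measurable:
  assumes "0 \<le> s" "s \<le> t"
  shows "increment s t \<in> M \<rightarrow>\<^sub>M borel \<Otimes>\<^sub>M borel \<Otimes>\<^sub>M borel"
proof -
  have [measurable]: "B s \<in> borel_measurable M" "B2 s \<in> borel_measurable M" "B3 s \<in> borel_measurable M"
     "B t \<in> borel_measurable M" "B2 t \<in> borel_measurable M" "B3 t \<in> borel_measurable M"
    using assms by (auto intro: B_measurable)
  show ?thesis
    unfolding increment_def[abs_def] by measurable
qed

lemma increment_indep_set:
  assumes "0 \<le> s" "s \<le> t"
  shows "indep_set (sets (F s)) (sets (vimage_algebra (space M) (increment s t) (borel \<Otimes>\<^sub>M borel \<Otimes>\<^sub>M borel)))"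
  using filt assms unfolding brownian_filtration_def increment_def[abs_def] by blast

lemma increment_coordinates_indep:
  assumes "0 \<le> s" "s \<le> t"
  shows "indep_vars (\<lambda>_. borel) (\<lambda>i \<omega>. ([B, B2, B3] ! i) t \<omega> - ([B, B2, B3] ! i) s \<omega>) {..<3}"
proof -
  have "indep_vars (\<lambda>_. borel)
      (\<lambda>i \<omega>. (\<lambda>f. f t - f s) (\<lambda>t\<in>{0..}. ([B, B2, B3] ! i) t \<omega>)) {..<length [B, B2, B3]}"
    using assms
    by (intro indep_vars_compose2[OF indep[unfolded independent_processes_def]] borel_measurable_diff
        measurable_component_singleton) auto
  then show ?thesis
    using assms by (simp add: eval_nat_numeral cong: indep_vars_cong)
qed

lemma bm_nth: "i < 3 \<Longrightarrow> standard_brownian_motion M ([B, B2, B3] ! i)"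
  using bm by (auto simp: less_Suc_eq eval_nat_numeral)

lemma bm_increment_char:
  assumes "standard_brownian_motion M X" "0 \<le> s" "s \<le> t"
  shows "(\<integral>\<omega>. iexp (r * (X t \<omega> - X s \<omega>)) \<partial>M) = exp (- ((t - s) * r\<^sup>2 / 2))"
proof (cases "s = t")
  case True
  then show ?thesis by (simp add: prob_space)
next
  case False
  then have "distributed M lborel (\<lambda>\<omega>. X t \<omega> - X s \<omega>) (normal_density 0 (sqrt (t - s)))"
    using assms unfolding standard_brownian_motion_def by auto
  from char_normal[OF this, of r] False assms show ?thesis by simp
qed

lemma bm_increment_moments:
  assumes "standard_brownian_motion M X" "0 \<le> s" "s \<le> t"
  shows "integrable M (\<lambda>\<omega>. X t \<omega> - X s \<omega>)" "(\<integral>\<omega>. X t \<omega> - X s \<omega> \<partial>M) = 0"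
    "integrable M (\<lambda>\<omega>. (X t \<omega> - X s \<omega>)\<^sup>2)" "(\<integral>\<omega>. (X t \<omega> - X s \<omega>)\<^sup>2 \<partial>M) = t - s"
proof -
  have "integrable M (\<lambda>\<omega>. X t \<omega> - X s \<omega>) \<and> (\<integral>\<omega>. X t \<omega> - X s \<omega> \<partial>M) = 0 \<and>
    integrable M (\<lambda>\<omega>. (X t \<omega> - X s \<omega>)\<^sup>2) \<and> (\<integral>\<omega>. (X t \<omega> - X s \<omega>)\<^sup>2 \<partial>M) = t - s"
  proof (cases "s = t")
    case False
    then have "distributed M lborel (\<lambda>\<omega>. X t \<omega> - X s \<omega>) (normal_density 0 (sqrt (t - s)))"
      using assms unfolding standard_brownian_motion_def by auto
    from normal_moments[OF this] False assms show ?thesis by simp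
  qed simp
  then show "integrable M (\<lambda>\<omega>. X t \<omega> - X s \<omega>)" "(\<integral>\<omega>. X t \<omega> - X s \<omega> \<partial>M) = 0"
    "integrable M (\<lambda>\<omega>. (X t \<omega> - X s \<omega>)\<^sup>2)" "(\<integral>\<omega>. (X t \<omega> - X s \<omega>)\<^sup>2 \<partial>M) = t - s"
    by auto
qed

text \<open>
  The three increments are independent centred normal variables with variance \<open>t - s\<close>; hence
  the exponential of a linear form and the square of a linear form have explicit means.
\<close>

lemma increment_char:
  assumes st: "0 \<le> s" "s \<le> t"
  shows "(\<integral>\<omega>. iexp (a * (B t \<omega> - B s \<omega>) + b * (B2 t \<omega> - B2 s \<omega>) + c * (B3 t \<omega> - B3 s \<omega>)) \<partial>M)
    = exp (- ((a\<^sup>2 + b\<^sup>2 + c\<^sup>2) * (t - s) / 2))"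
proof -
  define D where "D i \<omega> = ([B, B2, B3] ! i) t \<omega> - ([B, B2, B3] ! i) s \<omega>" for i \<omega>
  define e where "e i = [a, b, c] ! i" for i
  have ind: "indep_vars (\<lambda>_. borel) (\<lambda>i \<omega>. iexp (e i * D i \<omega>)) {..<3}"
    unfolding D_def by (intro indep_vars_compose2[OF increment_coordinates_indep[OF st]]) measurable
  then have rv: "i < 3 \<Longrightarrow> (\<lambda>\<omega>. iexp (e i * D i \<omega>)) \<in> borel_measurable M" for i
    unfolding indep_vars_def2 by auto
  have "(\<integral>\<omega>. iexp (a * (B t \<omega> - B s \<omega>) + b * (B2 t \<omega> - B2 s \<omega>) + c * (B3 t \<omega> - B3 s \<omega>)) \<partial>M)
     = (\<integral>\<omega>. (\<Prod>i<3. iexp (e i * D i \<omega>)) \<partial>M)"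
    by (intro Bochner_Integration.integral_cong)
       (simp_all add: eval_nat_numeral D_def e_def exp_add[symmetric] algebra_simps)
  also have "\<dots> = (\<Prod>i<3. \<integral>\<omega>. iexp (e i * D i \<omega>) \<partial>M)"
    by (intro indep_vars_lebesgue_integral ind integrable_const_bound[where B=1] rv) auto
  also have "\<dots> = (\<Prod>i<3. complex_of_real (exp (- ((t - s) * (e i)\<^sup>2 / 2))))"
    unfolding D_def by (intro prod.cong refl bm_increment_char bm_nth st) auto
  also have "\<dots> = complex_of_real (exp (- ((a\<^sup>2 + b\<^sup>2 + c\<^sup>2) * (t - s) / 2)))"
    by (simp add: eval_nat_numeral e_def exp_add[symmetric] of_real_mult[symmetric] del: of_real_mult)
       (simp add: field_simps)
  finally show ?thesis by simp
qed

lemma increment_second_moment: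
  assumes st: "0 \<le> s" "s \<le> t"
  shows "(\<integral>\<^sup>+\<omega>. ennreal ((x + (b * (B2 t \<omega> - B2 s \<omega>) + c * (B3 t \<omega> - B3 s \<omega>)))\<^sup>2) \<partial>M)
    = ennreal (x\<^sup>2 + (b\<^sup>2 + c\<^sup>2) * (t - s))"
proof -
  define D where "D i \<omega> = ([B, B2, B3] ! i) t \<omega> - ([B, B2, B3] ! i) s \<omega>" for i \<omega>
  have ind: "indep_vars (\<lambda>_. borel) D {1, 2}"
    unfolding D_def by (rule indep_vars_subset[OF increment_coordinates_indep[OF st]]) auto
  have D: "B2 t \<omega> - B2 s \<omega> = D 1 \<omega>" "B3 t \<omega> - B3 s \<omega> = D 2 \<omega>" for \<omega>
    by (simp_all add: D_def)
  have m: "integrable M (D i)" "(\<integral>\<omega>. D i \<omega> \<partial>M) = 0" "integrable M (\<lambda>\<omega>. (D i \<omega>)\<^sup>2)"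
    "(\<integral>\<omega>. (D i \<omega>)\<^sup>2 \<partial>M) = t - s" if "i < 3" for i
    using bm_increment_moments[OF bm_nth[OF that] st] unfolding D_def by auto
  have prod: "(\<Prod>i\<in>{1, 2}. D i \<omega>) = D 1 \<omega> * D 2 \<omega>" for \<omega>
    by simp
  have "integrable M (\<lambda>\<omega>. \<Prod>i\<in>{1, 2}. D i \<omega>)" "(\<integral>\<omega>. (\<Prod>i\<in>{1, 2}. D i \<omega>) \<partial>M) = (\<Prod>i\<in>{1, 2}. \<integral>\<omega>. D i \<omega> \<partial>M)"
    by (rule indep_vars_integrable indep_vars_lebesgue_integral; use ind m in auto)+
  then have p: "integrable M (\<lambda>\<omega>. D 1 \<omega> * D 2 \<omega>)" "(\<integral>\<omega>. D 1 \<omega> * D 2 \<omega> \<partial>M) = 0"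
    unfolding prod by (auto simp: m)
  have expand: "(x + (b * D 1 \<omega> + c * D 2 \<omega>))\<^sup>2 = x\<^sup>2 + 2 * x * b * D 1 \<omega> + 2 * x * c * D 2 \<omega>
     + b\<^sup>2 * (D 1 \<omega>)\<^sup>2 + c\<^sup>2 * (D 2 \<omega>)\<^sup>2 + 2 * b * c * (D 1 \<omega> * D 2 \<omega>)" for \<omega>
    by (simp add: power2_eq_square algebra_simps)
  have "integrable M (\<lambda>\<omega>. (x + (b * D 1 \<omega> + c * D 2 \<omega>))\<^sup>2)"
    unfolding expand by (intro Bochner_Integration.integrable_add integrable_mult_right integrable_const m p) auto
  moreover have "(\<integral>\<omega>. (x + (b * D 1 \<omega> + c * D 2 \<omega>))\<^sup>2 \<partial>M) = x\<^sup>2 + (b\<^sup>2 + c\<^sup>2) * (t - s)"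
    unfolding expand using m[of 1] m[of 2] p by (simp add: prob_space distrib_right)
  ultimately show ?thesis
    unfolding D by (simp add: nn_integral_eq_integral)
qed

lemma Re_mult_noise:
  "Re (z * (W t \<omega> - W s \<omega>))
     = Re z / sqrt 2 * (B2 t \<omega> - B2 s \<omega>) + - (Im z / sqrt 2) * (B3 t \<omega> - B3 s \<omega>)"
  by (simp add: complex_noise_def algebra_simps diff_divide_distrib)

text \<open>
  The factor \<open>1/\<surd>2\<close> in \<open>W\<close> gives \<open>Re (z dW)\<close> the variance \<open>|z|\<^sup>2 dt / 2\<close>, whatever the direction of \<open>z\<close>.
\<close>

lemma noise_char:
  assumes st: "0 \<le> s" "s \<le> t"
  shows "(\<integral>\<omega>. iexp (r * (B t \<omega> - B s \<omega> + Re (z * (W t \<omega> - W s \<omega>)))) \<partial>M)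
    = exp (- (r\<^sup>2 * (1 + (norm z)\<^sup>2 / 2) * (t - s) / 2))"
proof -
  have "r * (B t \<omega> - B s \<omega> + Re (z * (W t \<omega> - W s \<omega>))) = r * (B t \<omega> - B s \<omega>)
     + (r * (Re z / sqrt 2)) * (B2 t \<omega> - B2 s \<omega>) + (r * - (Im z / sqrt 2)) * (B3 t \<omega> - B3 s \<omega>)" for \<omega>
    unfolding Re_mult_noise by (simp add: algebra_simps)
  moreover have "r\<^sup>2 + (r * (Re z / sqrt 2))\<^sup>2 + (r * - (Im z / sqrt 2))\<^sup>2 = r\<^sup>2 * (1 + (norm z)\<^sup>2 / 2)"
    by (simp add: cmod_power2 power_mult_distrib power_divide algebra_simps)
  ultimately show ?thesis
    using increment_char[OF st, of r "r * (Re z / sqrt 2)" "r * - (Im z / sqrt 2)"] by simp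
qed

lemma noise_second_moment:
  assumes st: "0 \<le> s" "s \<le> t"
  shows "(\<integral>\<^sup>+\<omega>. ennreal ((x + Re (z * (W t \<omega> - W s \<omega>)))\<^sup>2) \<partial>M)
    = ennreal (x\<^sup>2) + ennreal ((norm z)\<^sup>2 / 2 * (t - s))"
proof -
  have "(Re z / sqrt 2)\<^sup>2 + (- (Im z / sqrt 2))\<^sup>2 = (norm z)\<^sup>2 / 2"
    by (simp add: cmod_power2 power_divide)
  then show ?thesis
    using increment_second_moment[OF st, of x "Re z / sqrt 2" "- (Im z / sqrt 2)"] st
    unfolding Re_mult_noise by (simp only:) simp
qed

end

section \<open>Stochastic sums over a partition\<close>

lemma mono_upto:
  fixes v :: "nat \<Rightarrow> real"
  assumes "\<And>i. i < n \<Longrightarrow> v i \<le> v (Suc i)" "i \<le> j" "j \<le> n"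
  shows "v i \<le> v j"
  using assms(2,3) by (induction rule: dec_induct) (use assms(1) in \<open>auto intro: order_trans\<close>)

lemma simple_integral_Suc:
  "simple_integral W (Suc n) v \<xi> \<omega> = simple_integral W n v \<xi> \<omega> + \<xi> n \<omega> * (W (v (Suc n)) \<omega> - W (v n) \<omega>)"
  by (simp add: simple_integral_def)

lemma partition_indicator:
  fixes v :: "nat \<Rightarrow> real"
  assumes v: "\<And>i. i < n \<Longrightarrow> v i \<le> v (Suc i)" and i: "i < n" "s \<in> {v i<..v (Suc i)}" and j: "j < n"
  shows "indicator {v j<..v (Suc j)} s = (if j = i then 1 else 0)"
proof (cases j i rule: linorder_cases)
  case less
  then have "v (Suc j) \<le> v i" using i mono_upto[of n v "Suc j" i] v by auto
  with less i show ?thesis by (auto simp: indicator_def)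
next
  case greater
  then have "v (Suc i) \<le> v j" using j mono_upto[of n v "Suc i" j] v by auto
  with greater i show ?thesis by (auto simp: indicator_def)
qed (use i in auto)

text \<open>
  At a time inside the \<open>i\<close>-th interval a step function takes its \<open>i\<close>-th value, since the intervals
  are disjoint.
\<close>

lemma partition_sum:
  fixes v :: "nat \<Rightarrow> real" and f :: "nat \<Rightarrow> 'b::semiring_1"
  assumes v: "\<And>i. i < n \<Longrightarrow> v i \<le> v (Suc i)" and i: "i < n" "s \<in> {v i<..v (Suc i)}"
  shows "(\<Sum>j<n. f j * indicator {v j<..v (Suc j)} s) = f i"
proof -
  have "(\<Sum>j<n. f j * indicator {v j<..v (Suc j)} s) = (\<Sum>j<n. if j = i then f j else 0)"
    by (rule sum.cong) (simp_all add: partition_indicator[OF v i])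
  then show ?thesis
    using i by simp
qed

lemma iexp_add: "iexp (x + y) = iexp x * iexp y"
  by (simp add: exp_add[symmetric] distrib_left)

context brownian_triple
begin

lemma simple_integral_measurable_F:
  assumes v: "0 \<le> v 0" "\<And>i. i < n \<Longrightarrow> v i \<le> v (Suc i)"
    and \<xi>: "\<And>i. i < n \<Longrightarrow> \<xi> i \<in> borel_measurable (F (v i))"
  shows "simple_integral W n v \<xi> \<in> borel_measurable (F (v n))"
proof -
  have "(\<lambda>\<omega>. \<xi> i \<omega> * (W (v (Suc i)) \<omega> - W (v i) \<omega>)) \<in> borel_measurable (F (v n))" if "i < n" for i
  proof -
    have le: "0 \<le> v i" "v i \<le> v (Suc i)" "v (Suc i) \<le> v n"
      using mono_upto[of n v 0 i] mono_upto[of n v "Suc i" n] v that by auto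
    then have [measurable]: "\<xi> i \<in> borel_measurable (F (v n))"
      using measurable_F_mono[OF _ \<xi>[OF that]] by auto
    have [measurable]: "W (v i) \<in> borel_measurable (F (v n))" "W (v (Suc i)) \<in> borel_measurable (F (v n))"
      using le by (auto intro!: B_measurable_F)
    show ?thesis by measurable
  qed
  then show ?thesis
    unfolding simple_integral_def[abs_def] by (intro borel_measurable_sum) auto
qed

text \<open>
  Given the past of \<open>v i\<close>, the \<open>i\<close>-th summand \<open>dB + Re (\<eta> i dW)\<close> is centred normal with variance
  \<open>3/2 (v (i+1) - v i)\<close>. As \<open>|\<eta> i| = 1\<close>, this conditional law does not depend on the past, so the summands
  contribute deterministic factors one after the other, although the coefficients \<open>\<eta> i\<close> may be
  complicated functions of the earlier increments.
\<close>

lemma unit_sum_char: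
  assumes v: "0 \<le> v 0" "\<And>i. i < n \<Longrightarrow> v i \<le> v (Suc i)"
    and \<eta>: "\<And>i. i < n \<Longrightarrow> \<eta> i \<in> borel_measurable (F (v i))"
    and unit: "\<And>i \<omega>. i < n \<Longrightarrow> norm (\<eta> i \<omega>) = 1"
  shows "(\<integral>\<omega>. iexp (r * (B (v n) \<omega> - B (v 0) \<omega> + Re (simple_integral W n v \<eta> \<omega>))) \<partial>M)
     = exp (- (3 / 4 * r\<^sup>2 * (v n - v 0)))"
  using v(2) \<eta> unit
proof (induction n)
  case 0
  then show ?case by (simp add: simple_integral_def prob_space)
next
  case (Suc n)
  let ?S = "\<lambda>\<omega>. B (v n) \<omega> - B (v 0) \<omega> + Re (simple_integral W n v \<eta> \<omega>)"
  let ?G = "increment (v n) (v (Suc n))"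
  have vn: "0 \<le> v 0" "v 0 \<le> v n" "0 \<le> v n" "v n \<le> v (Suc n)"
    using v(1) mono_upto[of n v 0 n] Suc.prems(1) by auto
  have [measurable]: "simple_integral W n v \<eta> \<in> borel_measurable (F (v n))"
    using Suc.prems v(1) by (intro simple_integral_measurable_F) auto
  have [measurable]: "B (v n) \<in> borel_measurable (F (v n))" "B (v 0) \<in> borel_measurable (F (v n))"
    "\<eta> n \<in> borel_measurable (F (v n))"
    using vn Suc.prems(2) by (auto intro!: B_measurable_F)
  have X: "(\<lambda>\<omega>. (?S \<omega>, \<eta> n \<omega>)) \<in> F (v n) \<rightarrow>\<^sub>M borel \<Otimes>\<^sub>M borel"
    by measurable
  define f :: "(real \<times> complex) \<times> real \<times> real \<times> real \<Rightarrow> complex" where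
    "f = (\<lambda>p. iexp (r * (fst (fst p) + (fst (snd p) + (Re (snd (fst p)) / sqrt 2 * fst (snd (snd p))
            + - (Im (snd (fst p)) / sqrt 2) * snd (snd (snd p)))))))"
  have f[measurable]: "f \<in> borel_measurable ((borel \<Otimes>\<^sub>M borel) \<Otimes>\<^sub>M borel \<Otimes>\<^sub>M borel \<Otimes>\<^sub>M borel)"
    unfolding f_def by measurable
  have norm_f: "norm (f p) \<le> 1" for p
    by (simp add: f_def)
  have f_noise: "f ((x, z), ?G \<omega>)
      = iexp (r * (x + (B (v (Suc n)) \<omega> - B (v n) \<omega> + Re (z * (W (v (Suc n)) \<omega> - W (v n) \<omega>)))))" for x z \<omega>
    unfolding Re_mult_noise by (simp only: f_def increment_def fst_conv snd_conv)
  have inner: "(\<integral>\<omega>'. f ((x, z), ?G \<omega>') \<partial>M) = iexp (r * x) * exp (- (3 / 4 * r\<^sup>2 * (v (Suc n) - v n)))"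
    if "norm z = 1" for x z
  proof -
    have "(\<integral>\<omega>'. f ((x, z), ?G \<omega>') \<partial>M) = iexp (r * x) *
        (\<integral>\<omega>. iexp (r * (B (v (Suc n)) \<omega> - B (v n) \<omega> + Re (z * (W (v (Suc n)) \<omega> - W (v n) \<omega>)))) \<partial>M)"
      unfolding f_noise distrib_left[of r x] iexp_add by (rule integral_mult_right_zero)
    also have "\<dots> = iexp (r * x) * exp (- (r\<^sup>2 * (1 + (norm z)\<^sup>2 / 2) * (v (Suc n) - v n) / 2))"
      unfolding noise_char[OF vn(3,4)] ..
    also have "- (r\<^sup>2 * (1 + (norm z)\<^sup>2 / 2) * (v (Suc n) - v n) / 2) = - (3 / 4 * r\<^sup>2 * (v (Suc n) - v n))"
      using that by simp
    finally show ?thesis .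
  qed
  have arg: "B (v (Suc n)) \<omega> - B (v 0) \<omega> + Re (simple_integral W (Suc n) v \<eta> \<omega>)
      = ?S \<omega> + (B (v (Suc n)) \<omega> - B (v n) \<omega> + Re (\<eta> n \<omega> * (W (v (Suc n)) \<omega> - W (v n) \<omega>)))" for \<omega>
    unfolding simple_integral_Suc plus_complex.sel by linarith
  have "(\<integral>\<omega>. iexp (r * (B (v (Suc n)) \<omega> - B (v 0) \<omega> + Re (simple_integral W (Suc n) v \<eta> \<omega>))) \<partial>M)
      = (\<integral>\<omega>. f ((?S \<omega>, \<eta> n \<omega>), ?G \<omega>) \<partial>M)"
    unfolding f_noise arg ..
  also have "\<dots> = (\<integral>\<omega>. (\<integral>\<omega>'. f ((?S \<omega>, \<eta> n \<omega>), ?G \<omega>') \<partial>M) \<partial>M)"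
    by (rule integral_indep_set[OF subalg increment_indep_set[OF vn(3,4)] X increment_measurable[OF vn(3,4)] f norm_f])
  also have "\<dots> = (\<integral>\<omega>. iexp (r * ?S \<omega>) * exp (- (3 / 4 * r\<^sup>2 * (v (Suc n) - v n))) \<partial>M)"
    using Suc.prems(3) by (subst inner) auto
  also have "\<dots> = (\<integral>\<omega>. iexp (r * ?S \<omega>) \<partial>M) * exp (- (3 / 4 * r\<^sup>2 * (v (Suc n) - v n)))"
    by simp
  also have "(\<integral>\<omega>. iexp (r * ?S \<omega>) \<partial>M) = exp (- (3 / 4 * r\<^sup>2 * (v n - v 0)))"
    by (rule Suc.IH) (use Suc.prems in auto)
  also have "complex_of_real (exp (- (3 / 4 * r\<^sup>2 * (v n - v 0)))) * complex_of_real (exp (- (3 / 4 * r\<^sup>2 * (v (Suc n) - v n))))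
     = complex_of_real (exp (- (3 / 4 * r\<^sup>2 * (v (Suc n) - v 0))))"
    by (subst of_real_mult[symmetric], subst exp_add[symmetric]) (simp add: algebra_simps diff_divide_distrib)
  finally show ?case .
qed

text \<open>
  The cross terms vanish because each increment is centred given the past. The identity is one between
  elements of \<open>[0,\<infinity>]\<close>, valid also for unbounded coefficients. The factor \<open>1/2\<close> appears because only the real part
  is taken.
\<close>

lemma ito_isometry:
  assumes v: "0 \<le> v 0" "\<And>i. i < n \<Longrightarrow> v i \<le> v (Suc i)"
    and \<xi>: "\<And>i. i < n \<Longrightarrow> \<xi> i \<in> borel_measurable (F (v i))"
  shows "(\<integral>\<^sup>+\<omega>. ennreal ((Re (simple_integral W n v \<xi> \<omega>))\<^sup>2) \<partial>M)
     = (\<integral>\<^sup>+\<omega>. (\<Sum>i<n. ennreal ((norm (\<xi> i \<omega>))\<^sup>2 / 2 * (v (Suc i) - v i))) \<partial>M)"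
  using v(2) \<xi>
proof (induction n)
  case 0
  then show ?case by (simp add: simple_integral_def)
next
  case (Suc n)
  let ?S = "\<lambda>\<omega>. Re (simple_integral W n v \<xi> \<omega>)"
  let ?G = "increment (v n) (v (Suc n))"
  have vn: "0 \<le> v 0" "v 0 \<le> v n" "0 \<le> v n" "v n \<le> v (Suc n)"
    using v(1) mono_upto[of n v 0 n] Suc.prems(1) by auto
  have [measurable]: "simple_integral W n v \<xi> \<in> borel_measurable (F (v n))"
    using Suc.prems v(1) by (intro simple_integral_measurable_F) auto
  have [measurable]: "\<xi> n \<in> borel_measurable (F (v n))"
    using Suc.prems(2) by auto
  have \<xi>M: "\<xi> i \<in> borel_measurable M" if "i < Suc n" for i
    by (rule measurable_M[OF Suc.prems(2)[OF that]])
  have [measurable]: "simple_integral W n v \<xi> \<in> borel_measurable M" "\<xi> n \<in> borel_measurable M"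
    by (rule measurable_M[where t="v n"], measurable)+
  have X: "(\<lambda>\<omega>. (?S \<omega>, \<xi> n \<omega>)) \<in> F (v n) \<rightarrow>\<^sub>M borel \<Otimes>\<^sub>M borel"
    by measurable
  define f :: "(real \<times> complex) \<times> real \<times> real \<times> real \<Rightarrow> ennreal" where
    "f = (\<lambda>p. ennreal ((fst (fst p) + (Re (snd (fst p)) / sqrt 2 * fst (snd (snd p))
            + - (Im (snd (fst p)) / sqrt 2) * snd (snd (snd p))))\<^sup>2))"
  have f[measurable]: "f \<in> borel_measurable ((borel \<Otimes>\<^sub>M borel) \<Otimes>\<^sub>M borel \<Otimes>\<^sub>M borel \<Otimes>\<^sub>M borel)"
    unfolding f_def by measurable
  have f_noise: "f ((x, z), ?G \<omega>) = ennreal ((x + Re (z * (W (v (Suc n)) \<omega> - W (v n) \<omega>)))\<^sup>2)" for x z \<omega>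
    unfolding Re_mult_noise by (simp only: f_def increment_def fst_conv snd_conv)
  have "(\<integral>\<^sup>+\<omega>. ennreal ((Re (simple_integral W (Suc n) v \<xi> \<omega>))\<^sup>2) \<partial>M) = (\<integral>\<^sup>+\<omega>. f ((?S \<omega>, \<xi> n \<omega>), ?G \<omega>) \<partial>M)"
    unfolding f_noise simple_integral_Suc plus_complex.sel ..
  also have "\<dots> = (\<integral>\<^sup>+\<omega>. (\<integral>\<^sup>+\<omega>'. f ((?S \<omega>, \<xi> n \<omega>), ?G \<omega>') \<partial>M) \<partial>M)"
    by (rule nn_integral_indep_set[OF subalg increment_indep_set[OF vn(3,4)] X increment_measurable[OF vn(3,4)] f])
  also have "\<dots> = (\<integral>\<^sup>+\<omega>. ennreal ((?S \<omega>)\<^sup>2) + ennreal ((norm (\<xi> n \<omega>))\<^sup>2 / 2 * (v (Suc n) - v n)) \<partial>M)"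
    unfolding f_noise noise_second_moment[OF vn(3,4)] ..
  also have "\<dots> = (\<integral>\<^sup>+\<omega>. ennreal ((?S \<omega>)\<^sup>2) \<partial>M) + (\<integral>\<^sup>+\<omega>. ennreal ((norm (\<xi> n \<omega>))\<^sup>2 / 2 * (v (Suc n) - v n)) \<partial>M)"
    by (rule nn_integral_add) auto
  also have "(\<integral>\<^sup>+\<omega>. ennreal ((?S \<omega>)\<^sup>2) \<partial>M) = (\<integral>\<^sup>+\<omega>. (\<Sum>i<n. ennreal ((norm (\<xi> i \<omega>))\<^sup>2 / 2 * (v (Suc i) - v i))) \<partial>M)"
    by (rule Suc.IH) (use Suc.prems in auto)
  also have "\<dots> + (\<integral>\<^sup>+\<omega>. ennreal ((norm (\<xi> n \<omega>))\<^sup>2 / 2 * (v (Suc n) - v n)) \<partial>M)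
     = (\<integral>\<^sup>+\<omega>. (\<Sum>i<Suc n. ennreal ((norm (\<xi> i \<omega>))\<^sup>2 / 2 * (v (Suc i) - v i))) \<partial>M)"
    using \<xi>M by (subst nn_integral_add[symmetric]) (auto intro!: borel_measurable_sum measurable_compose[OF \<xi>M])
  finally show ?case .
qed

end

section \<open>Ito integrals of integrands of modulus one\<close>

lemma norm_iexp_diff_le: "norm (iexp x - iexp y) \<le> \<bar>x - y\<bar>"
proof -
  have "iexp x - iexp y = iexp y * (iexp (x - y) - 1)"
    using iexp_add[of y "x - y"] by (simp add: algebra_simps)
  then have "norm (iexp x - iexp y) = norm (iexp (x - y) - 1)"
    by (simp add: norm_mult)
  also have "\<dots> \<le> \<bar>x - y\<bar>"
    using iexp_approx1[of "x - y" 0] by simp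
  finally show ?thesis .
qed

text \<open>
  Mean-square convergence implies convergence of characteristic functions, as \<open>e\<^bsup>irx\<^esup>\<close> is
  \<open>|r|\<close>-Lipschitz. If the characteristic functions of the approximations do not depend on \<open>m\<close>, the limit
  inherits their common value.
\<close>

lemma (in prob_space) char_L2_limit:
  assumes [measurable]: "\<And>m. X m \<in> borel_measurable M" "Y \<in> borel_measurable M"
    and lim: "(\<lambda>m::nat. \<integral>\<^sup>+\<omega>. ennreal ((X m \<omega> - Y \<omega>)\<^sup>2) \<partial>M) \<longlonglongrightarrow> 0"
    and char: "\<And>m. (\<integral>\<omega>. iexp (r * X m \<omega>) \<partial>M) = c"
  shows "(\<integral>\<omega>. iexp (r * Y \<omega>) \<partial>M) = c"
proof -
  have "norm (c - (\<integral>\<omega>. iexp (r * Y \<omega>) \<partial>M)) \<le> e" if e: "e > 0" for e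
  proof -
    let ?d = "\<lambda>m. \<integral>\<^sup>+\<omega>. ennreal ((X m \<omega> - Y \<omega>)\<^sup>2) \<partial>M"
    have int: "integrable M (\<lambda>\<omega>. iexp (r * Y \<omega>))" "integrable M (\<lambda>\<omega>. iexp (r * X m \<omega>))" for m
      by (rule integrable_const_bound[where B=1]; simp)+
    have "ennreal (norm (c - (\<integral>\<omega>. iexp (r * Y \<omega>) \<partial>M))) \<le> ennreal e + ennreal (r\<^sup>2 / (4 * e)) * ?d m" for m
    proof -
      have "c - (\<integral>\<omega>. iexp (r * Y \<omega>) \<partial>M) = (\<integral>\<omega>. iexp (r * X m \<omega>) - iexp (r * Y \<omega>) \<partial>M)"
        unfolding char[of m, symmetric] by (rule Bochner_Integration.integral_diff[OF int(2,1), symmetric])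
      then have "ennreal (norm (c - (\<integral>\<omega>. iexp (r * Y \<omega>) \<partial>M)))
          \<le> (\<integral>\<^sup>+\<omega>. ennreal (norm (iexp (r * X m \<omega>) - iexp (r * Y \<omega>))) \<partial>M)"
        using integral_norm_bound_ennreal[OF Bochner_Integration.integrable_diff[OF int(2,1)]] by simp
      also have "\<dots> \<le> (\<integral>\<^sup>+\<omega>. ennreal e + ennreal (r\<^sup>2 / (4 * e)) * ennreal ((X m \<omega> - Y \<omega>)\<^sup>2) \<partial>M)"
      proof (rule nn_integral_mono)
        fix \<omega>
        \<comment> \<open>\<open>d \<le> e + d\<^sup>2 / (4 e)\<close> trades the first moment of \<open>d\<close> for the second one, which is controlled.\<close>
        define d where "d = \<bar>r * X m \<omega> - r * Y \<omega>\<bar>"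
        have "0 \<le> (d - 2 * e)\<^sup>2"
          by simp
        then have "d * (4 * e) \<le> e * (4 * e) + d\<^sup>2"
          by (simp add: power2_eq_square algebra_simps)
        then have "d \<le> e + d\<^sup>2 / (4 * e)"
          using e by (simp add: field_simps)
        also have "d\<^sup>2 / (4 * e) = r\<^sup>2 / (4 * e) * (X m \<omega> - Y \<omega>)\<^sup>2"
          by (simp add: d_def power_mult_distrib right_diff_distrib[symmetric])
        finally have "norm (iexp (r * X m \<omega>) - iexp (r * Y \<omega>)) \<le> e + r\<^sup>2 / (4 * e) * (X m \<omega> - Y \<omega>)\<^sup>2"
          using norm_iexp_diff_le[of "r * X m \<omega>" "r * Y \<omega>"] unfolding d_def by linarith
        then show "ennreal (norm (iexp (r * X m \<omega>) - iexp (r * Y \<omega>)))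
            \<le> ennreal e + ennreal (r\<^sup>2 / (4 * e)) * ennreal ((X m \<omega> - Y \<omega>)\<^sup>2)"
          using e by (simp add: ennreal_mult[symmetric] ennreal_plus[symmetric] del: ennreal_plus)
      qed
      also have "\<dots> = ennreal e + ennreal (r\<^sup>2 / (4 * e)) * ?d m"
        by (simp add: nn_integral_add nn_integral_cmult emeasure_space_1)
      finally show ?thesis .
    qed
    moreover have "(\<lambda>m. ennreal e + ennreal (r\<^sup>2 / (4 * e)) * ?d m) \<longlonglongrightarrow> ennreal e + ennreal (r\<^sup>2 / (4 * e)) * 0"
      by (intro tendsto_add tendsto_const ennreal_tendsto_cmult lim) simp
    ultimately have "ennreal (norm (c - (\<integral>\<omega>. iexp (r * Y \<omega>) \<partial>M))) \<le> ennreal e + ennreal (r\<^sup>2 / (4 * e)) * 0"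
      by (intro LIMSEQ_le_const) auto
    then show ?thesis
      using e by simp
  qed
  then have "norm (c - (\<integral>\<omega>. iexp (r * Y \<omega>) \<partial>M)) \<le> 0"
    by (rule dense_ge)
  then show ?thesis by simp
qed

lemma (in prob_space) distributed_normal_char:
  assumes [measurable]: "Y \<in> borel_measurable M" and \<sigma>: "\<sigma> > 0"
    and char: "\<And>r. (\<integral>\<omega>. iexp (r * Y \<omega>) \<partial>M) = exp (- (\<sigma>\<^sup>2 * r\<^sup>2 / 2))"
  shows "distributed M lborel Y (normal_density 0 \<sigma>)"
proof -
  let ?N = "density lborel (\<lambda>x. ennreal (normal_density 0 \<sigma> x))"
  interpret N: prob_space ?N
    by (rule prob_space_normal_density[OF \<sigma>])
  have "real_distribution ?N"
    by (simp add: real_distribution_def real_distribution_axioms_def N.prob_space_axioms)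
  moreover have "real_distribution (distr M borel Y)"
    by simp
  moreover have "char (distr M borel Y) = char ?N"
  proof
    fix r
    have "distributed ?N lborel (\<lambda>x. x) (normal_density 0 \<sigma>)"
      by (simp add: distributed_def distr_id2)
    from N.char_normal[OF this \<sigma>, of r] char[of r] show "char (distr M borel Y) r = char ?N r"
      by (simp add: char_def integral_distr)
  qed
  ultimately have "distr M borel Y = ?N"
    by (intro Levy_uniqueness)
  moreover have "distr M borel Y = distr M lborel Y"
    by (rule distr_cong) auto
  ultimately show ?thesis
    by (simp add: distributed_def)
qed

text \<open>
  At \<open>0\<close> every point of the circle is equally near, so the value there is arbitrary as long as its modulus is one.
\<close>

definition unit_dir :: "complex \<Rightarrow> complex" where
  "unit_dir z = (if z = 0 then 1 else sgn z)"

lemma norm_unit_dir [simp]: "norm (unit_dir z) = 1"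
  by (simp add: unit_dir_def norm_sgn)

lemma unit_dir_measurable [measurable]: "unit_dir \<in> borel_measurable borel"
  unfolding unit_dir_def[abs_def] sgn_div_norm by measurable

text \<open>
  The distance of \<open>z\<close> to its direction is \<open>|1 - |z||\<close>, and the triangle inequality bounds this by the distance
  to any point of the circle. This is what allows an approximation of a unimodular process to be made
  unimodular at no loss.
\<close>

lemma unit_dir_nearest:
  assumes "norm w = 1"
  shows "norm (unit_dir z - z) \<le> norm (z - w)"
proof (cases "z = 0")
  case False
  then have "unit_dir z - z = complex_of_real (1 - norm z) * sgn z"
    by (simp add: unit_dir_def algebra_simps sgn_div_norm)
       (simp add: scaleR_conv_of_real)
  then have "norm (unit_dir z - z) = \<bar>1 - norm z\<bar>"
    using False by (simp add: norm_mult norm_sgn del: of_real_diff)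
  also have "\<dots> \<le> norm (z - w)"
    using norm_triangle_ineq3[of z w] assms by linarith
  finally show ?thesis .
qed (use assms in \<open>simp add: unit_dir_def\<close>)

text \<open>
  A simple integrand may be supported on a part \<open>[u 0, u n]\<close> of \<open>[0,T]\<close>. The two functions below add the
  intervals \<open>[0, u 0]\<close> and \<open>[u n, T]\<close> with coefficient \<open>0\<close>. Once the coefficients are replaced by their
  directions, the partition has to exhaust \<open>[0,T]\<close> for the total variance to be \<open>3T/2\<close>.
\<close>

definition fill_times :: "real \<Rightarrow> nat \<Rightarrow> (nat \<Rightarrow> real) \<Rightarrow> nat \<Rightarrow> real" where
  "fill_times T n u i = (case i of 0 \<Rightarrow> 0 | Suc j \<Rightarrow> if j \<le> n then u j else T)"

definition fill_coeffs :: "nat \<Rightarrow> (nat \<Rightarrow> 'a \<Rightarrow> complex) \<Rightarrow> nat \<Rightarrow> 'a \<Rightarrow> complex" where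
  "fill_coeffs n \<xi> i = (case i of 0 \<Rightarrow> (\<lambda>_. 0) | Suc j \<Rightarrow> if j < n then \<xi> j else (\<lambda>_. 0))"

lemma sum_fill:
  fixes f :: "complex \<Rightarrow> real \<Rightarrow> real \<Rightarrow> complex"
  assumes "\<And>x y. f 0 x y = 0"
  shows "(\<Sum>i<Suc (Suc n). f (fill_coeffs n \<xi> i \<omega>) (fill_times T n u i) (fill_times T n u (Suc i)))
    = (\<Sum>i<n. f (\<xi> i \<omega>) (u i) (u (Suc i)))"
  unfolding sum.lessThan_Suc_shift
  by (subst sum.lessThan_Suc_shift[symmetric], simp only: sum.lessThan_Suc)
     (simp add: assms fill_coeffs_def fill_times_def)

lemma simple_integral_fill:
  "simple_integral W (Suc (Suc n)) (fill_times T n u) (fill_coeffs n \<xi>) \<omega> = simple_integral W n u \<xi> \<omega>"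
  unfolding simple_integral_def using sum_fill[of "\<lambda>z s t. z * (W t \<omega> - W s \<omega>)"] by simp

lemma simple_process_fill:
  "simple_process (Suc (Suc n)) (fill_times T n u) (fill_coeffs n \<xi>) s \<omega> = simple_process n u \<xi> s \<omega>"
  unfolding simple_process_def using sum_fill[of "\<lambda>z x y. z * indicator {x<..y} s"] by simp

lemma simple_integrand_fill:
  assumes \<xi>: "simple_integrand F T n u \<xi>"
  shows "fill_times T n u 0 = 0" "fill_times T n u (Suc (Suc n)) = T"
    "\<And>i. i < Suc (Suc n) \<Longrightarrow> fill_times T n u i \<le> fill_times T n u (Suc i)"
    "\<And>i. i < Suc (Suc n) \<Longrightarrow> fill_coeffs n \<xi> i \<in> borel_measurable (F (fill_times T n u i))"
  using \<xi> by (auto simp: simple_integrand_def fill_times_def fill_coeffs_def less_Suc_eq_le le_Suc_eq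
      split: nat.split)

context brownian_triple
begin

text \<open>
  The variable \<open>X\<close> is the stochastic sum with the coefficients of the filled-up simple integrand replaced by
  their directions. Its distance to the original sum is controlled by the isometry: on the \<open>i\<close>-th interval
  the coefficient moves by at most the distance of the simple process to \<open>H\<close> at any time of that interval.
\<close>

lemma unit_approximation:
  assumes \<xi>: "simple_integrand F T n u \<xi>" and H: "\<And>s \<omega>. norm (H s \<omega>) = 1"
  obtains X where "X \<in> borel_measurable M"
    "\<And>r. (\<integral>\<omega>. iexp (r * X \<omega>) \<partial>M) = exp (- (3 / 4 * r\<^sup>2 * T))"
    "(\<integral>\<^sup>+\<omega>. ennreal ((X \<omega> - (B T \<omega> - B 0 \<omega> + Re (simple_integral W n u \<xi> \<omega>)))\<^sup>2) \<partial>M)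
      \<le> (\<integral>\<^sup>+\<omega>. (\<integral>\<^sup>+s\<in>{0..T}. ennreal ((norm (simple_process n u \<xi> s \<omega> - H s \<omega>))\<^sup>2) \<partial>lborel) \<partial>M)"
proof
  let ?N = "Suc (Suc n)"
  define v where "v = fill_times T n u"
  define \<zeta> where "\<zeta> = fill_coeffs n \<xi>"
  define \<eta> where "\<eta> i \<omega> = unit_dir (\<zeta> i \<omega>)" for i \<omega>
  define X where "X \<omega> = B (v ?N) \<omega> - B (v 0) \<omega> + Re (simple_integral W ?N v \<eta> \<omega>)" for \<omega>
  note fill = simple_integrand_fill[OF \<xi>, folded v_def \<zeta>_def]
  have \<eta>: "\<eta> i \<in> borel_measurable (F (v i))" if "i < ?N" for i
    unfolding \<eta>_def[abs_def] by (rule measurable_compose[OF fill(4)[OF that] unit_dir_measurable])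
  have T: "0 \<le> T"
    using mono_upto[of ?N v 0 ?N] fill by auto
  have [measurable]: "simple_integral W ?N v \<eta> \<in> borel_measurable M"
    by (rule measurable_M[OF simple_integral_measurable_F]) (use fill \<eta> in auto)
  show "X \<in> borel_measurable M"
    unfolding X_def[abs_def] fill using T by measurable
  show "(\<integral>\<omega>. iexp (r * X \<omega>) \<partial>M) = exp (- (3 / 4 * r\<^sup>2 * T))" for r
    unfolding X_def using unit_sum_char[of v ?N \<eta> r] fill \<eta> by (simp add: \<eta>_def)
  have diff: "X \<omega> - (B T \<omega> - B 0 \<omega> + Re (simple_integral W n u \<xi> \<omega>))
      = Re (simple_integral W ?N v (\<lambda>i \<omega>. \<eta> i \<omega> - \<zeta> i \<omega>) \<omega>)" for \<omega>
  proof -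
    have "simple_integral W n u \<xi> \<omega> = simple_integral W ?N v \<zeta> \<omega>"
      unfolding v_def \<zeta>_def simple_integral_fill ..
    moreover have "simple_integral W ?N v (\<lambda>i \<omega>. \<eta> i \<omega> - \<zeta> i \<omega>) \<omega>
        = simple_integral W ?N v \<eta> \<omega> - simple_integral W ?N v \<zeta> \<omega>"
      by (simp add: simple_integral_def left_diff_distrib sum_subtractf del: sum.lessThan_Suc)
    ultimately show ?thesis
      by (simp add: X_def fill)
  qed
  have "(\<integral>\<^sup>+\<omega>. ennreal ((Re (simple_integral W ?N v (\<lambda>i \<omega>. \<eta> i \<omega> - \<zeta> i \<omega>) \<omega>))\<^sup>2) \<partial>M)
      = (\<integral>\<^sup>+\<omega>. (\<Sum>i<?N. ennreal ((norm (\<eta> i \<omega> - \<zeta> i \<omega>))\<^sup>2 / 2 * (v (Suc i) - v i))) \<partial>M)"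
    by (rule ito_isometry) (use fill \<eta> in \<open>auto intro!: borel_measurable_diff simp del: lessThan_Suc\<close>)
  also have "\<dots> \<le> (\<integral>\<^sup>+\<omega>. (\<integral>\<^sup>+s\<in>{0..T}. ennreal ((norm (simple_process n u \<xi> s \<omega> - H s \<omega>))\<^sup>2) \<partial>lborel) \<partial>M)"
  proof (rule nn_integral_mono)
    fix \<omega>
    let ?D = "\<lambda>i. ennreal ((norm (\<eta> i \<omega> - \<zeta> i \<omega>))\<^sup>2)"
    have "(\<Sum>i<?N. ennreal ((norm (\<eta> i \<omega> - \<zeta> i \<omega>))\<^sup>2 / 2 * (v (Suc i) - v i)))
        \<le> (\<Sum>i<?N. ?D i * emeasure lborel {v i<..v (Suc i)})"
    proof (rule sum_mono)
      fix i assume "i \<in> {..<?N}"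
      then have "v i \<le> v (Suc i)" using fill by auto
      then show "ennreal ((norm (\<eta> i \<omega> - \<zeta> i \<omega>))\<^sup>2 / 2 * (v (Suc i) - v i)) \<le> ?D i * emeasure lborel {v i<..v (Suc i)}"
        by (auto simp: ennreal_mult[symmetric] intro!: ennreal_leI mult_right_mono)
    qed
    also have "\<dots> = (\<integral>\<^sup>+s. (\<Sum>i<?N. ?D i * indicator {v i<..v (Suc i)} s) \<partial>lborel)"
      by (subst nn_integral_sum) (auto simp: nn_integral_cmult_indicator simp del: sum.lessThan_Suc)
    also have "\<dots> \<le> (\<integral>\<^sup>+s\<in>{0..T}. ennreal ((norm (simple_process n u \<xi> s \<omega> - H s \<omega>))\<^sup>2) \<partial>lborel)"
    proof (rule nn_integral_mono)
      fix s
      show "(\<Sum>i<?N. ?D i * indicator {v i<..v (Suc i)} s)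
        \<le> ennreal ((norm (simple_process n u \<xi> s \<omega> - H s \<omega>))\<^sup>2) * indicator {0..T} s"
      proof (cases "\<exists>i<?N. s \<in> {v i<..v (Suc i)}")
        case True
        then obtain i where i: "i < ?N" "s \<in> {v i<..v (Suc i)}" by auto
        have "0 \<le> v i" "v (Suc i) \<le> T"
          using mono_upto[of ?N v 0 i] mono_upto[of ?N v "Suc i" ?N] fill i by auto
        then have s: "s \<in> {0..T}"
          using i by auto
        have "simple_process n u \<xi> s \<omega> = simple_process ?N v \<zeta> s \<omega>"
          unfolding v_def \<zeta>_def simple_process_fill ..
        also have "\<dots> = \<zeta> i \<omega>"
          unfolding simple_process_def by (rule partition_sum[OF fill(3) i])
        finally have "norm (\<eta> i \<omega> - \<zeta> i \<omega>) \<le> norm (simple_process n u \<xi> s \<omega> - H s \<omega>)"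
          unfolding \<eta>_def using unit_dir_nearest[OF H] by simp
        then have "?D i \<le> ennreal ((norm (simple_process n u \<xi> s \<omega> - H s \<omega>))\<^sup>2)"
          by (simp add: ennreal_leI power_mono)
        moreover have "(\<Sum>j<?N. ?D j * indicator {v j<..v (Suc j)} s) = ?D i"
          by (rule partition_sum[OF fill(3) i])
        ultimately show ?thesis
          using s by (simp only: indicator_simps mult_1_right)
      qed auto
    qed
    finally show "(\<Sum>i<?N. ennreal ((norm (\<eta> i \<omega> - \<zeta> i \<omega>))\<^sup>2 / 2 * (v (Suc i) - v i)))
      \<le> (\<integral>\<^sup>+s\<in>{0..T}. ennreal ((norm (simple_process n u \<xi> s \<omega> - H s \<omega>))\<^sup>2) \<partial>lborel)" .
  qed
  finally show "(\<integral>\<^sup>+\<omega>. ennreal ((X \<omega> - (B T \<omega> - B 0 \<omega> + Re (simple_integral W n u \<xi> \<omega>)))\<^sup>2) \<partial>M)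
      \<le> (\<integral>\<^sup>+\<omega>. (\<integral>\<^sup>+s\<in>{0..T}. ennreal ((norm (simple_process n u \<xi> s \<omega> - H s \<omega>))\<^sup>2) \<partial>lborel) \<partial>M)"
    unfolding diff .
qed

text \<open>
  An instance of Levy's characterisation of Brownian motion: the quadratic variation of
  \<open>B + Re \<integral> H dW\<close> is deterministic, with a share \<open>T\<close> from \<open>B\<close> and \<open>T/2\<close> from the integral.
\<close>

lemma unit_ito_integral_normal:
  assumes T: "T > 0" and ito: "has_ito_integral M F W H T J" and H: "\<And>s \<omega>. norm (H s \<omega>) = 1"
  shows "distributed M lborel (\<lambda>\<omega>. B T \<omega> - B 0 \<omega> + Re (J \<omega>)) (normal_density 0 (sqrt (3 / 2 * T)))"
proof -
  obtain n u \<xi> where \<xi>: "\<And>m::nat. simple_integrand F T (n m) (u m) (\<xi> m)"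
    and lim1: "(\<lambda>m. \<integral>\<^sup>+\<omega>. (\<integral>\<^sup>+s\<in>{0..T}.
             ennreal ((norm (simple_process (n m) (u m) (\<xi> m) s \<omega> - H s \<omega>))\<^sup>2) \<partial>lborel) \<partial>M) \<longlonglongrightarrow> 0"
    and lim2: "(\<lambda>m. \<integral>\<^sup>+\<omega>. ennreal ((norm (simple_integral W (n m) (u m) (\<xi> m) \<omega> - J \<omega>))\<^sup>2) \<partial>M) \<longlonglongrightarrow> 0"
    and [measurable]: "J \<in> borel_measurable M"
    using ito unfolding has_ito_integral_def by blast
  let ?Y = "\<lambda>\<omega>. B T \<omega> - B 0 \<omega> + Re (J \<omega>)"
  let ?Z = "\<lambda>m \<omega>. B T \<omega> - B 0 \<omega> + Re (simple_integral W (n m) (u m) (\<xi> m) \<omega>)"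
  let ?a = "\<lambda>m. \<integral>\<^sup>+\<omega>. (\<integral>\<^sup>+s\<in>{0..T}.
             ennreal ((norm (simple_process (n m) (u m) (\<xi> m) s \<omega> - H s \<omega>))\<^sup>2) \<partial>lborel) \<partial>M"
  let ?b = "\<lambda>m. \<integral>\<^sup>+\<omega>. ennreal ((norm (simple_integral W (n m) (u m) (\<xi> m) \<omega> - J \<omega>))\<^sup>2) \<partial>M"
  have [measurable]: "B T \<in> borel_measurable M" "B 0 \<in> borel_measurable M"
    using T by (auto intro: B_measurable)
  have "\<exists>X. X \<in> borel_measurable M \<and> (\<forall>r. (\<integral>\<omega>. iexp (r * X \<omega>) \<partial>M) = exp (- (3 / 4 * r\<^sup>2 * T))) \<and>
      (\<integral>\<^sup>+\<omega>. ennreal ((X \<omega> - ?Z m \<omega>)\<^sup>2) \<partial>M) \<le> ?a m" (is "\<exists>X. ?P m X") for m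
    by (rule unit_approximation[where H=H, OF \<xi>[of m] H]) (intro exI conjI allI)
  then have "\<exists>X. \<forall>m. ?P m (X m)"
    by (intro choice allI)
  then obtain X where P: "\<forall>m. ?P m (X m)"
    by (rule exE)
  have X[measurable]: "X m \<in> borel_measurable M"
    and char: "(\<integral>\<omega>. iexp (r * X m \<omega>) \<partial>M) = exp (- (3 / 4 * r\<^sup>2 * T))"
    and le: "(\<integral>\<^sup>+\<omega>. ennreal ((X m \<omega> - ?Z m \<omega>)\<^sup>2) \<partial>M) \<le> ?a m" for m r
    by (simp_all only: spec[OF P, of m])
  have Y[measurable]: "?Y \<in> borel_measurable M"
    by measurable
  have Zm[measurable]: "simple_integral W (n m) (u m) (\<xi> m) \<in> borel_measurable M" for m
  proof (rule measurable_M[OF simple_integral_measurable_F])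
    show "0 \<le> u m 0" "\<And>i. i < n m \<Longrightarrow> u m i \<le> u m (Suc i)"
      "\<And>i. i < n m \<Longrightarrow> \<xi> m i \<in> borel_measurable (F (u m i))"
      using \<xi>[of m] by (simp_all add: simple_integrand_def)
  qed
  have bound: "(\<integral>\<^sup>+\<omega>. ennreal ((X m \<omega> - ?Y \<omega>)\<^sup>2) \<partial>M) \<le> 2 * ?a m + 2 * ?b m" for m
  proof -
    have "(\<integral>\<^sup>+\<omega>. ennreal ((X m \<omega> - ?Y \<omega>)\<^sup>2) \<partial>M)
       \<le> (\<integral>\<^sup>+\<omega>. 2 * ennreal ((X m \<omega> - ?Z m \<omega>)\<^sup>2)
           + 2 * ennreal ((norm (simple_integral W (n m) (u m) (\<xi> m) \<omega> - J \<omega>))\<^sup>2) \<partial>M)"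
    proof (rule nn_integral_mono)
      fix \<omega>
      define p where "p = X m \<omega> - ?Z m \<omega>"
      define q where "q = Re (simple_integral W (n m) (u m) (\<xi> m) \<omega> - J \<omega>)"
      have "X m \<omega> - ?Y \<omega> = p + q"
        by (simp add: p_def q_def)
      moreover have "0 \<le> (p - q)\<^sup>2" "q\<^sup>2 \<le> (norm (simple_integral W (n m) (u m) (\<xi> m) \<omega> - J \<omega>))\<^sup>2"
        unfolding q_def by (auto simp: cmod_power2)
      ultimately have "(X m \<omega> - ?Y \<omega>)\<^sup>2 \<le> 2 * p\<^sup>2 + 2 * (norm (simple_integral W (n m) (u m) (\<xi> m) \<omega> - J \<omega>))\<^sup>2"
        by (simp add: power2_sum power2_diff)
      then show "ennreal ((X m \<omega> - ?Y \<omega>)\<^sup>2) \<le> 2 * ennreal ((X m \<omega> - ?Z m \<omega>)\<^sup>2)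
           + 2 * ennreal ((norm (simple_integral W (n m) (u m) (\<xi> m) \<omega> - J \<omega>))\<^sup>2)"
        unfolding p_def[symmetric]
        by (simp add: ennreal_plus[symmetric] ennreal_mult[symmetric] ennreal_numeral[symmetric]
            del: ennreal_plus ennreal_numeral)
    qed
    also have "\<dots> = 2 * (\<integral>\<^sup>+\<omega>. ennreal ((X m \<omega> - ?Z m \<omega>)\<^sup>2) \<partial>M) + 2 * ?b m"
      by (subst nn_integral_add) (auto simp: nn_integral_cmult)
    also have "\<dots> \<le> 2 * ?a m + 2 * ?b m"
      by (intro add_mono mult_left_mono le) auto
    finally show ?thesis .
  qed
  have "(\<lambda>m. 2 * ?a m + 2 * ?b m) \<longlonglongrightarrow> 2 * 0 + 2 * 0"
    by (intro tendsto_add ennreal_tendsto_cmult lim1 lim2) auto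
  then have lim: "(\<lambda>m. 2 * ?a m + 2 * ?b m) \<longlonglongrightarrow> 0"
    by simp
  have "(\<lambda>m. \<integral>\<^sup>+\<omega>. ennreal ((X m \<omega> - ?Y \<omega>)\<^sup>2) \<partial>M) \<longlonglongrightarrow> 0"
    by (rule tendsto_sandwich[OF _ _ tendsto_const lim]) (auto intro!: always_eventually bound)
  from char_L2_limit[OF X Y this char] show ?thesis
    using T by (intro distributed_normal_char Y) (auto simp: field_simps)
qed

end

section \<open>The periodised normal density\<close>

lemma p_dens_eq_normal_density:
  assumes "\<tau> > 0"
  shows "p_dens \<tau> y = normal_density 0 (sqrt (3 / 2 * \<tau>)) y"
  using assms by (simp add: p_dens_def normal_density_def mult.commute)

lemma p_dens_nonneg: "\<tau> > 0 \<Longrightarrow> 0 \<le> p_dens \<tau> y"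
  by (simp add: p_dens_def)

lemma p_dens_measurable [measurable]: "p_dens \<tau> \<in> borel_measurable borel"
  unfolding p_dens_def[abs_def] by measurable

lemma summable_on_power_nat_abs:
  fixes q :: real
  assumes q: "0 \<le> q" "q < 1"
  shows "(\<lambda>k::int. q ^ nat \<bar>k\<bar>) summable_on UNIV"
proof -
  have geo: "(\<lambda>n. q ^ n) summable_on UNIV"
    using q by (intro norm_summable_imp_summable_on) (simp add: power_abs summable_geometric)
  have "(\<lambda>k::int. q ^ nat \<bar>k\<bar>) summable_on range int"
    using geo by (subst summable_on_reindex) (auto simp: o_def)
  moreover have "(\<lambda>k::int. q ^ nat \<bar>k\<bar>) summable_on range (\<lambda>n. - int (Suc n))"
  proof (subst summable_on_reindex)
    have "(\<lambda>n. q * q ^ n) summable_on UNIV"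
      by (rule summable_on_cmult_right[OF geo])
    then show "((\<lambda>k::int. q ^ nat \<bar>k\<bar>) \<circ> (\<lambda>n. - int (Suc n))) summable_on UNIV"
      by (simp add: o_def nat_add_distrib)
  qed (auto simp: inj_on_def)
  ultimately have "(\<lambda>k::int. q ^ nat \<bar>k\<bar>) summable_on (range int \<union> range (\<lambda>n. - int (Suc n)))"
    by (rule summable_on_Un_disjoint) auto
  moreover have "range int \<union> range (\<lambda>n. - int (Suc n)) = UNIV"
  proof (intro set_eqI iffI UNIV_I)
    fix k :: int
    show "k \<in> range int \<union> range (\<lambda>n. - int (Suc n))"
      by (cases k rule: int_cases) auto
  qed
  ultimately show ?thesis by simp
qed

text \<open>
  From \<open>y\<^sup>2 \<ge> 2|y| - 1\<close> and \<open>|2\<pi>k + x| \<ge> |k| - |x|\<close>, the terms are dominated by a two-sided geometric series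
  with ratio \<open>e\<^bsup>-2c\<^esup>\<close>, where \<open>c = 1/(3\<tau>)\<close>.
\<close>

lemma p_dens_summable:
  assumes \<tau>: "\<tau> > 0"
  shows "(\<lambda>k::int. p_dens \<tau> (2 * pi * of_int k + x)) summable_on UNIV"
proof -
  define c where "c = 1 / (3 * \<tau>)"
  define K where "K = 1 / sqrt (3 * pi * \<tau>) * exp (c * (2 * \<bar>x\<bar> + 1))"
  have c: "c > 0" using \<tau> by (simp add: c_def)
  have "(\<lambda>k::int. K * exp (- 2 * c) ^ nat \<bar>k\<bar>) summable_on UNIV"
    using c by (intro summable_on_cmult_right summable_on_power_nat_abs) auto
  then show ?thesis
  proof (rule summable_on_comparison_test)
    fix k :: int
    define y where "y = 2 * pi * of_int k + x"
    have "\<bar>of_int k :: real\<bar> \<le> \<bar>2 * pi * of_int k\<bar>"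
      using pi_ge_two by (auto simp: abs_mult mult_le_cancel_right1)
    also have "\<dots> \<le> \<bar>y\<bar> + \<bar>x\<bar>"
      unfolding y_def by linarith
    finally have "2 * \<bar>of_int k\<bar> \<le> 2 * \<bar>y\<bar> + 2 * \<bar>x\<bar>" by simp
    also have "2 * \<bar>y\<bar> \<le> y\<^sup>2 + 1"
      using zero_le_power2[of "\<bar>y\<bar> - 1"] by (simp add: power2_diff)
    finally have "- y\<^sup>2 \<le> (2 * \<bar>x\<bar> + 1) + real (nat \<bar>k\<bar>) * (- 2)"
      by simp
    then have "c * - y\<^sup>2 \<le> c * ((2 * \<bar>x\<bar> + 1) + real (nat \<bar>k\<bar>) * (- 2))"
      using c by (intro mult_left_mono) auto
    then have "exp (- c * y\<^sup>2) \<le> exp (c * (2 * \<bar>x\<bar> + 1) + real (nat \<bar>k\<bar>) * (- 2 * c))"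
      by (simp add: algebra_simps)
    also have "\<dots> = exp (c * (2 * \<bar>x\<bar> + 1)) * exp (- 2 * c) ^ nat \<bar>k\<bar>"
      by (simp only: exp_add exp_of_nat_mult)
    finally have "1 / sqrt (3 * pi * \<tau>) * exp (- c * y\<^sup>2)
       \<le> 1 / sqrt (3 * pi * \<tau>) * (exp (c * (2 * \<bar>x\<bar> + 1)) * exp (- 2 * c) ^ nat \<bar>k\<bar>)"
      using \<tau> by (intro mult_left_mono) auto
    then show "p_dens \<tau> (2 * pi * of_int k + x) \<le> K * exp (- 2 * c) ^ nat \<bar>k\<bar>"
      unfolding y_def[symmetric] by (simp add: p_dens_def K_def c_def)
  qed (simp add: p_dens_nonneg[OF \<tau>])
qed

text \<open>
  Rewriting the sum as an integral against counting measure makes Tonelli's theorem available for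
  exchanging it with other integrals. Summability at every \<open>x\<close> matters here: a divergent \<open>infsum\<close> would be \<open>0\<close>.
\<close>

lemma intensity_dens_nn_integral:
  assumes \<tau>: "\<tau> > 0"
  shows "ennreal (intensity_dens \<tau> x) = (\<integral>\<^sup>+k. ennreal (p_dens \<tau> (2 * pi * of_int k + x)) \<partial>count_space (UNIV :: int set))"
proof -
  let ?f = "\<lambda>k::int. p_dens \<tau> (2 * pi * of_int k + x)"
  have abs: "Infinite_Set_Sum.abs_summable_on ?f UNIV"
    using p_dens_summable[OF \<tau>, of x]
    by (simp add: abs_summable_equivalent[symmetric] p_dens_nonneg[OF \<tau>])
  have "(\<integral>\<^sup>+k. ennreal (?f k) \<partial>count_space UNIV) = ennreal (infsetsum ?f UNIV)"
    by (rule nn_integral_conv_infsetsum[OF abs]) (rule p_dens_nonneg[OF \<tau>])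
  also have "infsetsum ?f UNIV = intensity_dens \<tau> x"
    unfolding intensity_dens_def by (rule infsetsum_infsum[OF abs])
  finally show ?thesis ..
qed

lemma nn_integral_count_space_singleton_indicator:
  "(\<integral>\<^sup>+k. f k * indicator {a} k \<partial>count_space UNIV) = (f a :: ennreal)"
  by (subst nn_integral_indicator_singleton) (auto simp: one_ennreal_def[symmetric])

text \<open>
  Each \<open>y\<close> lies in exactly one of the intervals \<open>[pk, pk + p)\<close>, namely for \<open>k = \<lfloor>y/p\<rfloor>\<close>; then shift each
  interval to \<open>[0,p)\<close>.
\<close>

lemma nn_integral_period_decomposition:
  fixes f :: "real \<Rightarrow> ennreal"
  assumes f[measurable]: "f \<in> borel_measurable borel" and p: "p > 0"
  shows "(\<integral>\<^sup>+y. f y \<partial>lborel)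
    = (\<integral>\<^sup>+k. (\<integral>\<^sup>+x\<in>{0..<p}. f (p * of_int k + x) \<partial>lborel) \<partial>count_space (UNIV :: int set))"
proof -
  have ind: "indicator {p * of_int k..<p * of_int k + p} y = (indicator {\<lfloor>y / p\<rfloor>} k :: ennreal)" for k y
  proof -
    have "y \<in> {p * of_int k..<p * of_int k + p} \<longleftrightarrow> \<lfloor>y / p\<rfloor> = k"
      using p by (auto simp: floor_eq_iff field_simps)
    then show ?thesis by (auto simp: indicator_def)
  qed
  have "(\<integral>\<^sup>+y. f y \<partial>lborel)
      = (\<integral>\<^sup>+y. (\<integral>\<^sup>+k. f y * indicator {p * of_int k..<p * of_int k + p} y \<partial>count_space (UNIV :: int set)) \<partial>lborel)"
    unfolding ind nn_integral_count_space_singleton_indicator ..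
  also have "\<dots> = (\<integral>\<^sup>+k. (\<integral>\<^sup>+y. f y * indicator {p * of_int k..<p * of_int k + p} y \<partial>lborel) \<partial>count_space (UNIV :: int set))"
    by (rule nn_integral_count_space_nn_integral) auto
  also have "\<dots> = (\<integral>\<^sup>+k. (\<integral>\<^sup>+x\<in>{0..<p}. f (p * of_int k + x) \<partial>lborel) \<partial>count_space UNIV)"
  proof (rule nn_integral_cong)
    fix k :: int
    have "(\<integral>\<^sup>+y. f y * indicator {p * of_int k..<p * of_int k + p} y \<partial>lborel)
      = (\<integral>\<^sup>+x. f (p * of_int k + 1 * x) * indicator {p * of_int k..<p * of_int k + p} (p * of_int k + 1 * x) \<partial>lborel)"
      by (subst nn_integral_real_affine[where c=1 and t="p * of_int k"]) auto
    also have "\<dots> = (\<integral>\<^sup>+x\<in>{0..<p}. f (p * of_int k + x) \<partial>lborel)"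
      by (intro nn_integral_cong) (auto simp: indicator_def)
    finally show "(\<integral>\<^sup>+y. f y * indicator {p * of_int k..<p * of_int k + p} y \<partial>lborel)
      = (\<integral>\<^sup>+x\<in>{0..<p}. f (p * of_int k + x) \<partial>lborel)" .
  qed
  finally show ?thesis .
qed

lemma borel_measurable_nn_integral_int:
  fixes f :: "'a \<Rightarrow> int \<Rightarrow> ennreal"
  assumes [measurable]: "\<And>k. (\<lambda>\<omega>. f \<omega> k) \<in> borel_measurable M"
  shows "(\<lambda>\<omega>. \<integral>\<^sup>+k. f \<omega> k \<partial>count_space UNIV) \<in> borel_measurable M"
proof -
  have "(\<integral>\<^sup>+k. f \<omega> k \<partial>count_space UNIV) = (\<Sum>n. f \<omega> (int_decode n))" for \<omega>
    by (subst nn_integral_bij_count_space[OF bij_int_decode, symmetric]) (rule nn_integral_count_space_nat)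
  then show ?thesis
    by simp
qed

lemma intensity_dens_measurable:
  assumes "\<tau> > 0"
  shows "(\<lambda>x. ennreal (intensity_dens \<tau> x)) \<in> borel_measurable borel"
  unfolding intensity_dens_nn_integral[OF assms]
  by (rule borel_measurable_nn_integral_int) measurable

lemma distr_normal_rmod_2pi:
  assumes \<tau>: "\<tau> > 0"
  shows "distr (density lborel (normal_density 0 (sqrt (3 / 2 * \<tau>)))) borel (\<lambda>y. y rmod (2 * pi))
    = density lborel (\<lambda>x. ennreal (intensity_dens \<tau> x) * indicator {0..<2 * pi} x)" (is "?L = ?R")
proof (rule measure_eqI)
  have rm[measurable]: "(\<lambda>y. y rmod (2 * pi)) \<in> borel_measurable borel"
    unfolding rmod_def by measurable
  note [measurable] = intensity_dens_measurable[OF \<tau>]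
  fix A assume "A \<in> sets ?L"
  then have [measurable]: "A \<in> sets borel" by simp
  have "emeasure ?L A = (\<integral>\<^sup>+y. ennreal (p_dens \<tau> y) * indicator A (y rmod (2 * pi)) \<partial>lborel)"
    using measurable_sets[OF rm, of A]
    by (subst emeasure_distr, simp, simp, subst emeasure_density)
       (auto intro!: nn_integral_cong simp: p_dens_eq_normal_density[OF \<tau>] indicator_def)
  also have "\<dots> = (\<integral>\<^sup>+k. (\<integral>\<^sup>+x\<in>{0..<2 * pi}. ennreal (p_dens \<tau> (2 * pi * of_int k + x))
      * indicator A ((2 * pi * of_int k + x) rmod (2 * pi)) \<partial>lborel) \<partial>count_space (UNIV :: int set))"
    by (rule nn_integral_period_decomposition) auto
  also have "\<dots> = (\<integral>\<^sup>+k. (\<integral>\<^sup>+x. ennreal (p_dens \<tau> (2 * pi * of_int k + x))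
      * indicator (A \<inter> {0..<2 * pi}) x \<partial>lborel) \<partial>count_space (UNIV :: int set))"
    by (intro nn_integral_cong) (auto simp: indicator_def rmod_unique[where z=x and n=k for x k] mult.commute)
  also have "\<dots> = (\<integral>\<^sup>+x. (\<integral>\<^sup>+k. ennreal (p_dens \<tau> (2 * pi * of_int k + x))
      * indicator (A \<inter> {0..<2 * pi}) x \<partial>count_space (UNIV :: int set)) \<partial>lborel)"
    by (rule nn_integral_count_space_nn_integral[symmetric]) auto
  also have "\<dots> = (\<integral>\<^sup>+x. ennreal (intensity_dens \<tau> x) * indicator (A \<inter> {0..<2 * pi}) x \<partial>lborel)"
    unfolding intensity_dens_nn_integral[OF \<tau>] by (intro nn_integral_cong nn_integral_multc) auto
  also have "\<dots> = emeasure ?R A"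
    by (subst emeasure_density) (auto intro!: nn_integral_cong simp: indicator_def)
  finally show "emeasure ?L A = emeasure ?R A" .
qed simp

section \<open>Level crossings of an increasing random function\<close>

lemma real_analytic_isCont:
  assumes "real_analytic f"
  shows "isCont f x"
proof -
  obtain a r where r: "r > 0" and a: "\<And>y. \<bar>y - x\<bar> < r \<Longrightarrow> (\<lambda>n. a n * (y - x) ^ n) sums f y"
    using assms unfolding real_analytic_def by metis
  define g where "g h = (\<Sum>n. a n * h ^ n)" for h
  have "summable (\<lambda>n. a n * (r / 2) ^ n)"
    using sums_summable[OF a[of "x + r / 2"]] r by simp
  then have "isCont g 0"
    unfolding g_def using r by (rule_tac isCont_powser[where K="r / 2"]) auto
  then have "isCont (\<lambda>y. g (y - x)) x"
    by (rule_tac isCont_o2[where f="\<lambda>y. y - x" and g=g]) simp_all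
  moreover have "\<forall>\<^sub>F y in nhds x. f y = g (y - x)"
    unfolding eventually_nhds_metric
    using r a by (intro exI[of _ r]) (auto simp: dist_real_def g_def sums_iff)
  ultimately show ?thesis
    by (subst isCont_cong) auto
qed

text \<open>
  If \<open>f n \<le> c\<close> for all \<open>n\<close>, then \<open>f n - n \<le> c - n\<close> for each single \<open>n\<close>. The law of \<open>f n - n\<close> does
  not depend on \<open>n\<close>, so the probability of this tends to \<open>0\<close>.
\<close>

lemma (in prob_space) normal_drift_unbounded:
  fixes f :: "real \<Rightarrow> 'a \<Rightarrow> real"
  assumes [measurable]: "\<And>x. f x \<in> borel_measurable M" and \<sigma>: "\<sigma> > 0"
    and law: "\<And>x. distributed M lborel (\<lambda>\<omega>. f x \<omega> - x) (normal_density 0 \<sigma>)"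
  shows "AE \<omega> in M. \<exists>n::nat. c < f (real n) \<omega>"
proof -
  let ?N = "density lborel (\<lambda>x. ennreal (normal_density 0 \<sigma> x))"
  interpret N: real_distribution ?N
    using prob_space_normal_density[OF \<sigma>] by (simp add: real_distribution_def real_distribution_axioms_def)
  define E where "E = {\<omega>\<in>space M. \<forall>n::nat. f (real n) \<omega> \<le> c}"
  have [measurable]: "E \<in> sets M"
    unfolding E_def by measurable
  have "prob E \<le> cdf ?N (c - real n)" for n
  proof -
    have "prob E \<le> prob ((\<lambda>\<omega>. f (real n) \<omega> - real n) -` {..c - real n} \<inter> space M)"
      by (rule finite_measure_mono) (auto simp: E_def)
    also have "\<dots> = measure (distr M lborel (\<lambda>\<omega>. f (real n) \<omega> - real n)) {..c - real n}"
      by (rule measure_distr[symmetric]) auto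
    also have "\<dots> = cdf ?N (c - real n)"
      by (simp add: distributed_distr_eq_density[OF law] cdf_def)
    finally show ?thesis .
  qed
  moreover have "(\<lambda>n. cdf ?N (c - real n)) \<longlonglongrightarrow> 0"
    by (rule filterlim_compose[OF N.cdf_lim_at_bot]) real_asymp
  ultimately have "prob E \<le> 0"
    by (intro LIMSEQ_le_const) auto
  then have "prob E = 0"
    by (simp add: measure_le_0_iff)
  then have "AE \<omega> in M. \<omega> \<notin> E"
    by (simp add: prob_eq_0)
  then show ?thesis
    by (rule AE_mp) (auto simp: E_def not_le)
qed

text \<open>
  The crossing point \<open>N\<close> satisfies \<open>N \<le> a \<longleftrightarrow> c \<le> f a\<close>, and \<open>c \<le> f a\<close> says that \<open>c - (f a - a) \<le> a\<close>. Hence at each \<open>a\<close>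
  the distribution function of \<open>N\<close> agrees with that of \<open>c - (f a - a)\<close>, whose law, by symmetry, is normal
  with mean \<open>c\<close> and does not depend on \<open>a\<close>.
\<close>

lemma (in prob_space) normal_drift_crossing:
  fixes f :: "real \<Rightarrow> 'a \<Rightarrow> real"
  assumes f[measurable]: "\<And>x. f x \<in> borel_measurable M" and \<sigma>: "\<sigma> > 0"
    and law: "\<And>x. distributed M lborel (\<lambda>\<omega>. f x \<omega> - x) (normal_density 0 \<sigma>)"
    and mono: "AE \<omega> in M. strict_mono (\<lambda>x. f x \<omega>)" and cont: "AE \<omega> in M. \<forall>x. isCont (\<lambda>x. f x \<omega>) x"
  obtains N where "distributed M lborel N (normal_density c \<sigma>)" "AE \<omega> in M. \<forall>x. f x \<omega> = c \<longleftrightarrow> x = N \<omega>"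
proof -
  have up: "AE \<omega> in M. \<exists>n::nat. c < f (real n) \<omega>"
    by (rule normal_drift_unbounded[OF f \<sigma> law])
  \<comment> \<open>The reflected function \<open>- f (- x)\<close> satisfies the same hypotheses, so \<open>f\<close> is also unbounded below.\<close>
  have "distributed M lborel (\<lambda>\<omega>. - f (- x) \<omega> - x) (normal_density 0 \<sigma>)" for x
    using normal_density_affine[OF law[of "- x"] \<sigma>, of "- 1" 0] by simp
  then have "AE \<omega> in M. \<exists>n::nat. - c < - f (- real n) \<omega>"
    using \<sigma> by (intro normal_drift_unbounded[where \<sigma>=\<sigma>]) auto
  then have "AE \<omega> in M. \<exists>!x. f x \<omega> = c"
    using up mono cont
  proof eventually_elim
    case (elim \<omega>)
    then obtain m n :: nat where mn: "f (- real m) \<omega> < c" "c < f (real n) \<omega>"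
      by auto
    then obtain x where "f x \<omega> = c"
      using IVT'[of "\<lambda>x. f x \<omega>" "- real m" c "real n"] elim(4)
      by (auto intro!: continuous_at_imp_continuous_on)
    then show ?case
      using strict_mono_eq[OF elim(3)] by (intro ex1I[of _ x]) auto
  qed
  then have "AE \<omega> in M. (\<exists>!x. f x \<omega> = c) \<and> strict_mono (\<lambda>x. f x \<omega>)"
    using mono by eventually_elim simp
  then obtain Z where Z: "{\<omega>\<in>space M. \<not> ((\<exists>!x. f x \<omega> = c) \<and> strict_mono (\<lambda>x. f x \<omega>))} \<subseteq> Z"
    "emeasure M Z = 0" and [measurable]: "Z \<in> sets M"
    by (rule AE_E)
  \<comment> \<open>The constant on the null set \<open>Z\<close> makes \<open>N\<close> measurable for \<open>M\<close> itself, not only for its completion.\<close>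
  define N where "N \<omega> = (if \<omega> \<in> Z then 0 else THE x. f x \<omega> = c)" for \<omega>
  have N_iff: "f x \<omega> = c \<longleftrightarrow> x = N \<omega>" "c \<le> f x \<omega> \<longleftrightarrow> N \<omega> \<le> x" if "\<omega> \<in> space M" "\<omega> \<notin> Z" for \<omega> x
  proof -
    from Z(1) that have good: "(\<exists>!x. f x \<omega> = c) \<and> strict_mono (\<lambda>x. f x \<omega>)"
      by blast
    note ex = conjunct1[OF good] and sm = conjunct2[OF good]
    have N: "f (N \<omega>) \<omega> = c"
      using theI'[OF ex] \<open>\<omega> \<notin> Z\<close> by (simp only: N_def if_False)
    show "f x \<omega> = c \<longleftrightarrow> x = N \<omega>"
      using strict_mono_eq[OF sm, of x "N \<omega>"] N by simp
    show "c \<le> f x \<omega> \<longleftrightarrow> N \<omega> \<le> x"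
      using strict_mono_less_eq[OF sm, of "N \<omega>" x] N by simp
  qed
  have [measurable]: "N \<in> borel_measurable M"
    unfolding borel_measurable_iff_le
  proof
    fix a
    have "{\<omega> \<in> space M. N \<omega> \<le> a} = ({\<omega> \<in> space M. c \<le> f a \<omega>} - Z) \<union> (if 0 \<le> a then Z else {})"
      using N_iff(2)[of _ a] sets.sets_into_space[OF \<open>Z \<in> sets M\<close>] by (auto simp: N_def)
    then show "{\<omega> \<in> space M. N \<omega> \<le> a} \<in> sets M"
      by simp
  qed
  have "AE \<omega> in M. \<omega> \<notin> Z"
    using Z by (intro AE_not_in) auto
  then have ae: "AE \<omega> in M. \<forall>x. (f x \<omega> = c \<longleftrightarrow> x = N \<omega>) \<and> (c \<le> f x \<omega> \<longleftrightarrow> N \<omega> \<le> x)"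
    by (rule AE_mp) (use N_iff in auto)
  let ?D = "density lborel (\<lambda>x. ennreal (normal_density c \<sigma> x))"
  interpret D: real_distribution ?D
    using prob_space_normal_density[OF \<sigma>] by (simp add: real_distribution_def real_distribution_axioms_def)
  have "distr M borel N = ?D"
  proof (rule cdf_unique)
    show "real_distribution (distr M borel N)" by simp
    show "real_distribution ?D" ..
    show "cdf (distr M borel N) = cdf ?D"
    proof
      fix a
      have Y: "distributed M lborel (\<lambda>\<omega>. c + (- 1) * (f a \<omega> - a)) (normal_density c \<sigma>)"
        using normal_density_affine[OF law[of a] \<sigma>, of "- 1" c] by simp
      have "cdf (distr M borel N) a = prob (N -` {..a} \<inter> space M)"
        by (simp add: cdf_def measure_distr)
      also have "\<dots> = prob ((\<lambda>\<omega>. c + (- 1) * (f a \<omega> - a)) -` {..a} \<inter> space M)"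
        using ae by (intro finite_measure_eq_AE) (auto elim!: eventually_mono)
      also have "\<dots> = measure (distr M lborel (\<lambda>\<omega>. c + (- 1) * (f a \<omega> - a))) {..a}"
        by (rule measure_distr[symmetric]) auto
      also have "\<dots> = cdf ?D a"
        by (simp only: distributed_distr_eq_density[OF Y] cdf_def)
      finally show "cdf (distr M borel N) a = cdf ?D a" .
    qed
  qed
  moreover have "distr M borel N = distr M lborel N"
    by (rule distr_cong) auto
  ultimately have "distributed M lborel N (normal_density c \<sigma>)"
    by (simp add: distributed_def)
  moreover have "AE \<omega> in M. \<forall>x. f x \<omega> = c \<longleftrightarrow> x = N \<omega>"
    using ae by eventually_elim blast
  ultimately show ?thesis by (rule that)
qed

lemma emeasure_count_space_range_Int:
  assumes "inj g"
  shows "emeasure (count_space UNIV) (range g \<inter> A) = (\<integral>\<^sup>+k. indicator A (g k) \<partial>count_space UNIV)"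
proof -
  have "bij_betw g UNIV (range g)"
    using assms by (simp add: bij_betw_def)
  then have "(\<integral>\<^sup>+k. indicator A (g k) \<partial>count_space UNIV) = (\<integral>\<^sup>+y. indicator A y \<partial>count_space (range g))"
    by (rule nn_integral_bij_count_space)
  also have "\<dots> = (\<integral>\<^sup>+y. indicator (range g \<inter> A) y \<partial>count_space UNIV)"
    unfolding indicator_inter_arith by (subst nn_integral_count_space_indicator) (simp_all only: mult.commute NO_MATCH_def)
  finally show ?thesis by simp
qed

lemma borel_measurable_completion_cong_AE:
  fixes f g :: "'a \<Rightarrow> 'b::topological_space"
  assumes g: "g \<in> borel_measurable M" and ae: "AE \<omega> in M. f \<omega> = g \<omega>"
  shows "f \<in> borel_measurable (completion M)"
proof (rule measurableI)
  fix S :: "'b set" assume S: "S \<in> sets borel"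
  have "g -` S \<inter> space (completion M) \<in> sets (completion M)"
    using measurable_sets[OF measurable_completion[OF g] S] by simp
  note 1 = this
  have "AE \<omega> in completion M. \<omega> \<in> g -` S \<inter> space (completion M) \<longleftrightarrow> \<omega> \<in> f -` S \<inter> space (completion M)"
    using AE_completion[OF ae] by eventually_elim auto
  then show "f -` S \<inter> space (completion M) \<in> sets (completion M)"
    by (rule completion.in_sets_AE[OF _ 1]) auto
qed simp

section \<open>The phase and its intensity\<close>

context brownian_triple
begin

lemma phase_law:
  assumes sol: "solves_phase_sde M F B W l \<phi>" and t: "t > 0"
  shows "distributed M lborel (\<lambda>\<omega>. \<phi> t \<omega> - l * t) (normal_density 0 (sqrt (3 / 2 * t)))"
proof -
  have \<phi>[measurable]: "\<phi> t \<in> borel_measurable M"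
    using sol t by (intro measurable_M[where t=t]) (simp add: solves_phase_sde_def adapted_def)
  have "\<exists>J. has_ito_integral M F W (\<lambda>s \<omega>. exp (- \<i> * complex_of_real (\<phi> s \<omega>))) t J \<and>
      (AE \<omega> in M. \<phi> t \<omega> = l * t + B t \<omega> + Re (J \<omega>))"
    using sol less_imp_le[OF t] unfolding solves_phase_sde_def by blast
  then obtain J where J: "has_ito_integral M F W (\<lambda>s \<omega>. exp (- \<i> * complex_of_real (\<phi> s \<omega>))) t J"
    and eq: "AE \<omega> in M. \<phi> t \<omega> = l * t + B t \<omega> + Re (J \<omega>)"
    by (elim exE conjE)
  have [measurable]: "J \<in> borel_measurable M"
    using J by (simp add: has_ito_integral_def)
  have [measurable]: "B t \<in> borel_measurable M" "B 0 \<in> borel_measurable M"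
    using t by (auto intro: B_measurable)
  have B0: "AE \<omega> in M. B 0 \<omega> = 0"
    using bm by (simp add: standard_brownian_motion_def)
  have "distributed M lborel (\<lambda>\<omega>. B t \<omega> - B 0 \<omega> + Re (J \<omega>)) (normal_density 0 (sqrt (3 / 2 * t)))"
    by (rule unit_ito_integral_normal[OF t J]) simp
  moreover have "distr M lborel (\<lambda>\<omega>. B t \<omega> - B 0 \<omega> + Re (J \<omega>)) = distr M lborel (\<lambda>\<omega>. \<phi> t \<omega> - l * t)"
    by (rule distr_cong_AE) (use eq B0 in \<open>auto elim: eventually_elim2\<close>)
  ultimately show ?thesis
    by (simp add: distributed_def)
qed

end

theorem theorem10:
  fixes M :: "'a measure" and F :: "real \<Rightarrow> 'a measure"
    and B B2 B3 :: "real \<Rightarrow> 'a \<Rightarrow> real"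
    and \<phi> :: "real \<Rightarrow> real \<Rightarrow> 'a \<Rightarrow> real"
    and \<tau> :: real
  assumes "prob_space M"
    and "standard_brownian_motion M B"
    and "standard_brownian_motion M B2"
    and "standard_brownian_motion M B3"
    and "independent_processes M [B, B2, B3]"
    and "brownian_filtration M F B B2 B3"
    and "\<And>l. solves_phase_sde M F B (complex_noise B2 B3) l (\<phi> l)"
    and "AE \<omega> in M. \<forall>t>0. strict_mono (\<lambda>l. \<phi> l t \<omega>) \<and> real_analytic (\<lambda>l. \<phi> l t \<omega>)"
    and "\<tau> > 0"
  shows "(\<forall>A\<in>sets borel.
            Sch_count \<phi> \<tau> A \<in> borel_measurable (completion M) \<and>
            (\<integral>\<^sup>+\<omega>. Sch_count \<phi> \<tau> A \<omega> \<partial>M) = (\<integral>\<^sup>+x\<in>A. ennreal (intensity_dens \<tau> x) \<partial>lborel)) \<and>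
         distr (density lborel (normal_density 0 (sqrt (3 / 2 * \<tau>)))) borel (\<lambda>y. y rmod (2 * pi))
           = density lborel (\<lambda>x. ennreal (intensity_dens \<tau> x) * indicator {0..<2 * pi} x)"
proof (intro conjI ballI)
  note \<tau> = \<open>\<tau> > 0\<close>
  define \<sigma> where "\<sigma> = sqrt (3 / 2 * \<tau>)"
  have \<sigma>: "\<sigma> > 0" using \<tau> by (simp add: \<sigma>_def)
  interpret brownian_triple M F B B2 B3
    using assms by (simp add: brownian_triple_def brownian_triple_axioms_def)
  define f where "f x \<omega> = \<phi> (x / \<tau>) \<tau> \<omega>" for x \<omega>
  have f: "f x \<in> borel_measurable M" for x
    unfolding f_def[abs_def] using assms(7)[of "x / \<tau>"] \<tau>
    by (intro measurable_M[where t=\<tau>]) (simp add: solves_phase_sde_def adapted_def)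
  have law: "distributed M lborel (\<lambda>\<omega>. f x \<omega> - x) (normal_density 0 \<sigma>)" for x
    using phase_law[OF assms(7)[of "x / \<tau>"] \<tau>] \<tau> by (simp add: f_def \<sigma>_def)
  have regular: "AE \<omega> in M. strict_mono (\<lambda>x. f x \<omega>) \<and> (\<forall>x. isCont (\<lambda>x. f x \<omega>) x)"
    using assms(8)
  proof eventually_elim
    case (elim \<omega>)
    then have sm: "strict_mono (\<lambda>l. \<phi> l \<tau> \<omega>)" and an: "real_analytic (\<lambda>l. \<phi> l \<tau> \<omega>)"
      using \<tau> by blast+
    have "isCont (\<lambda>x. f x \<omega>) x" for x
      unfolding f_def using \<tau>
      by (rule_tac isCont_o2[where f="\<lambda>x. x / \<tau>" and g="\<lambda>l. \<phi> l \<tau> \<omega>"])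
         (simp_all add: real_analytic_isCont[OF an])
    moreover have "strict_mono (\<lambda>x. f x \<omega>)"
      unfolding f_def using \<tau> by (intro strict_monoI strict_monoD[OF sm]) (simp add: divide_strict_right_mono)
    ultimately show ?case by blast
  qed
  have "\<exists>N. distributed M lborel N (normal_density (2 * pi * of_int k) \<sigma>) \<and>
      (AE \<omega> in M. \<forall>x. f x \<omega> = 2 * pi * of_int k \<longleftrightarrow> x = N \<omega>)" for k :: int
  proof (rule normal_drift_crossing[OF f \<sigma> law])
    show "AE \<omega> in M. strict_mono (\<lambda>x. f x \<omega>)" "AE \<omega> in M. \<forall>x. isCont (\<lambda>x. f x \<omega>) x"
      using regular by auto
  qed (intro exI conjI)
  then have "\<exists>N. \<forall>k::int. distributed M lborel (N k) (normal_density (2 * pi * of_int k) \<sigma>) \<and>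
      (AE \<omega> in M. \<forall>x. f x \<omega> = 2 * pi * of_int k \<longleftrightarrow> x = N k \<omega>)"
    by (intro choice allI)
  then obtain N where N_law: "\<And>k::int. distributed M lborel (N k) (normal_density (2 * pi * of_int k) \<sigma>)"
    and N: "\<And>k::int. AE \<omega> in M. \<forall>x. f x \<omega> = 2 * pi * of_int k \<longleftrightarrow> x = N k \<omega>"
    by blast
  have Nm[measurable]: "N k \<in> borel_measurable M" for k
    using distributed_measurable[OF N_law[of k]] by simp
  fix A :: "real set" assume A[measurable]: "A \<in> sets borel"
  have "AE \<omega> in M. \<forall>k::int. \<forall>x. f x \<omega> = 2 * pi * of_int k \<longleftrightarrow> x = N k \<omega>"
    using N by (simp add: AE_all_countable)
  then have count: "AE \<omega> in M. Sch_count \<phi> \<tau> A \<omega> = (\<integral>\<^sup>+k. indicator A (N k \<omega>) \<partial>count_space UNIV)"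
  proof eventually_elim
    case (elim \<omega>)
    have "inj (\<lambda>k. N k \<omega>)"
    proof (rule injI)
      fix j k assume "N j \<omega> = N k \<omega>"
      then have "2 * pi * real_of_int j = 2 * pi * real_of_int k"
        using elim by metis
      then show "j = k" by simp
    qed
    moreover have "Sch \<phi> \<tau> \<omega> = range (\<lambda>k. N k \<omega>)"
      using elim by (auto simp: Sch_def f_def)
    ultimately show ?case
      by (simp add: Sch_count_def emeasure_count_space_range_Int)
  qed
  show "Sch_count \<phi> \<tau> A \<in> borel_measurable (completion M)"
    by (rule borel_measurable_completion_cong_AE[OF borel_measurable_nn_integral_int count]) measurable
  have "(\<integral>\<^sup>+\<omega>. Sch_count \<phi> \<tau> A \<omega> \<partial>M) = (\<integral>\<^sup>+\<omega>. (\<integral>\<^sup>+k. indicator A (N k \<omega>) \<partial>count_space UNIV) \<partial>M)"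
    by (rule nn_integral_cong_AE[OF count])
  also have "\<dots> = (\<integral>\<^sup>+k. (\<integral>\<^sup>+\<omega>. indicator A (N k \<omega>) \<partial>M) \<partial>count_space UNIV)"
    by (rule nn_integral_count_space_nn_integral) auto
  also have "\<dots> = (\<integral>\<^sup>+k. (\<integral>\<^sup>+x. ennreal (p_dens \<tau> (2 * pi * of_int (- k) + x)) * indicator A x \<partial>lborel) \<partial>count_space UNIV)"
  proof (rule nn_integral_cong)
    fix k :: int
    have "(\<integral>\<^sup>+\<omega>. indicator A (N k \<omega>) \<partial>M)
        = (\<integral>\<^sup>+x. ennreal (normal_density (2 * pi * of_int k) \<sigma> x) * indicator A x \<partial>lborel)"
      by (rule distributed_nn_integral[OF N_law, symmetric]) simp
    also have "\<dots> = (\<integral>\<^sup>+x. ennreal (p_dens \<tau> (2 * pi * of_int (- k) + x)) * indicator A x \<partial>lborel)"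
      by (simp add: p_dens_eq_normal_density[OF \<tau>] \<sigma>_def normal_density_def)
    finally show "(\<integral>\<^sup>+\<omega>. indicator A (N k \<omega>) \<partial>M)
        = (\<integral>\<^sup>+x. ennreal (p_dens \<tau> (2 * pi * of_int (- k) + x)) * indicator A x \<partial>lborel)" .
  qed
  also have "\<dots> = (\<integral>\<^sup>+k. (\<integral>\<^sup>+x. ennreal (p_dens \<tau> (2 * pi * of_int k + x)) * indicator A x \<partial>lborel) \<partial>count_space (UNIV :: int set))"
    by (rule nn_integral_bij_count_space[where g="uminus :: int \<Rightarrow> int"]) (rule bij_uminus)
  also have "\<dots> = (\<integral>\<^sup>+x. (\<integral>\<^sup>+k. ennreal (p_dens \<tau> (2 * pi * of_int k + x)) * indicator A x \<partial>count_space (UNIV :: int set)) \<partial>lborel)"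
    by (rule nn_integral_count_space_nn_integral[symmetric]) auto
  also have "\<dots> = (\<integral>\<^sup>+x\<in>A. ennreal (intensity_dens \<tau> x) \<partial>lborel)"
    unfolding intensity_dens_nn_integral[OF \<tau>] by (intro nn_integral_cong nn_integral_multc) auto
  finally show "(\<integral>\<^sup>+\<omega>. Sch_count \<phi> \<tau> A \<omega> \<partial>M) = (\<integral>\<^sup>+x\<in>A. ennreal (intensity_dens \<tau> x) \<partial>lborel)" .
qed (rule distr_normal_rmod_2pi[OF \<open>\<tau> > 0\<close>])

end
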